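(* Fix $0<\gamma<1$ and a constant $I>0$ (which may be arbitrarily large). Then there exists $\delta_0>0$, depending on $I$ (and on the fixed $\gamma$), such that the following holds for every constant $\delta$ with $|\delta|\le\delta_0$. Let $F,G$ be smooth real-valued functions on $\mathbb R$, and suppose that there exist $f,\underline f\in C^\infty(\mathbb R)$ satisfying $$\int_{\mathbb R}(1+|x|)^{2+2\gamma}\left(|f^{(k)}(x)|^2+|\underline f^{(k)}(x)|^2\right)dx\le I\qquad\text{for all integers }k\ge 0,$$ such that $$G(x)+F'(x)=\delta f(x),\qquad G(x)-F'(x)=\underline f(x)\qquad\text{for all }x\in\mathbb R.$$ Then the Cauchy problem for the relativistic string equation $$\left(\frac{\phi_t}{\sqrt{1+\phi_x^2-\phi_t^2}}\right)_t-\left(\frac{\phi_x}{\sqrt{1+\phi_x^2-\phi_t^2}}\right)_x=0,\qquad (\phi,\phi_t)|_{t=0}=(F(x),G(x)),$$ admits a unique and globally smooth solution $\phi\in C^\infty(\mathbb R^+\times\mathbb R)$.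
   Context: Here $\phi=\phi(t,x)$ is real-valued, $\phi_t=\partial_t\phi$, $\phi_x=\partial_x\phi$, $f^{(k)}=\frac{d^k f}{dx^k}$, and $\mathbb R^+$ is the half-line of times $t\ge 0$. A solution is understood to be time-like, i.e. $1+\phi_x^2-\phi_t^2>0$, so that the equation makes sense. *)

theory Defs
  imports "HOL-Analysis.Analysis"
begin

definition smooth :: "(real \<Rightarrow> real) \<Rightarrow> bool" where
  "smooth f \<longleftrightarrow> (\<forall>k. (deriv ^^ k) f differentiable_on UNIV)"

text \<open>
  Space-time points are pairs \<open>(t, x)\<close>. The half-plane is closed, so smoothness on it is
  smoothness up to the initial line \<open>t = 0\<close>, expressed by Frechet derivatives within the
  half-plane; values of functions at negative times play no role.
\<close>

definition half_plane :: "(real \<times> real) set" where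
  "half_plane = {0..} \<times> UNIV"

primrec Ck_on :: "nat \<Rightarrow> (real \<times> real) set \<Rightarrow> (real \<times> real \<Rightarrow> real) \<Rightarrow> bool" where
  "Ck_on 0 S u \<longleftrightarrow> continuous_on S u"
| "Ck_on (Suc k) S u \<longleftrightarrow>
    (\<exists>a b. (\<forall>p\<in>S. (u has_derivative (\<lambda>h. a p * fst h + b p * snd h)) (at p within S)) \<and>
           Ck_on k S a \<and> Ck_on k S b)"

definition smooth_on :: "(real \<times> real) set \<Rightarrow> (real \<times> real \<Rightarrow> real) \<Rightarrow> bool" where
  "smooth_on S u \<longleftrightarrow> (\<forall>k. Ck_on k S u)"

text \<open>The time derivative is one-sided at \<open>t = 0\<close>.\<close>

definition dt :: "(real \<times> real \<Rightarrow> real) \<Rightarrow> real \<times> real \<Rightarrow> real" where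
  "dt u p = vector_derivative (\<lambda>s. u (s, snd p)) (at (fst p) within {0..})"

definition dx :: "(real \<times> real \<Rightarrow> real) \<Rightarrow> real \<times> real \<Rightarrow> real" where
  "dx u p = deriv (\<lambda>y. u (fst p, y)) (snd p)"

definition timelike :: "(real \<times> real \<Rightarrow> real) \<Rightarrow> bool" where
  "timelike u \<longleftrightarrow> (\<forall>p\<in>half_plane. 1 + (dx u p)\<^sup>2 - (dt u p)\<^sup>2 > 0)"

definition string_equation :: "(real \<times> real \<Rightarrow> real) \<Rightarrow> bool" where
  "string_equation u \<longleftrightarrow>
    (\<forall>p\<in>half_plane.
       dt (\<lambda>q. dt u q / sqrt (1 + (dx u q)\<^sup>2 - (dt u q)\<^sup>2)) p
     - dx (\<lambda>q. dx u q / sqrt (1 + (dx u q)\<^sup>2 - (dt u q)\<^sup>2)) p = 0)"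

definition smooth_string_solution ::
    "(real \<Rightarrow> real) \<Rightarrow> (real \<Rightarrow> real) \<Rightarrow> (real \<times> real \<Rightarrow> real) \<Rightarrow> bool" where
  "smooth_string_solution F G u \<longleftrightarrow>
     smooth_on half_plane u \<and> timelike u \<and> string_equation u \<and>
     (\<forall>x. u (0, x) = F x \<and> dt u (0, x) = G x)"

text \<open>Integrability is required explicitly because the Bochner integral of a non-integrable
  function is \<open>0\<close>.\<close>

definition weighted_bound ::
    "real \<Rightarrow> real \<Rightarrow> (real \<Rightarrow> real) \<Rightarrow> (real \<Rightarrow> real) \<Rightarrow> bool" where
  "weighted_bound \<gamma> I f g \<longleftrightarrow>
    (\<forall>k. let w = (\<lambda>x. (1 + \<bar>x\<bar>) powr (2 + 2 * \<gamma>) *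
                     (\<bar>(deriv ^^ k) f x\<bar>\<^sup>2 + \<bar>(deriv ^^ k) g x\<bar>\<^sup>2))
         in integrable lborel w \<and> (LINT x|lborel. w x) \<le> I)"

end

theory Submission imports Defs
begin

text \<open>
  In one space dimension the string equation is solved explicitly. Write
  \<open>r = \<phi>\<^sub>x\<close>, \<open>q = \<phi>\<^sub>t\<close> and let \<open>l > n\<close> be the two characteristic speeds. Then \<open>l\<close> and \<open>q + l * r\<close> are
  constant along the curves of speed \<open>n\<close>. In null coordinates \<open>t + y\<close> and \<open>y\<close> the position and the
  solution are therefore \<open>x = X (t + y) - Y y\<close> and \<open>\<phi> = P (t + y) - Q y\<close>, where \<open>X'\<close> and \<open>Y'\<close> are the
  initial values \<open>U\<close> and \<open>V\<close> of the speeds \<open>l\<close> and \<open>n\<close>, reparametrised by the solution \<open>s\<close>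
  of \<open>s' = U s - V s\<close>.

  These formulas define a global smooth solution as soon as \<open>U \<alpha> - V \<beta>\<close> is bounded below by a
  positive constant for all \<open>\<alpha>\<close> and \<open>\<beta>\<close>. Here \<open>U\<close> is close to \<open>1\<close> when \<open>\<delta>\<close> is small, while \<open>V\<close> stays away
  from \<open>1\<close> by an amount depending only on the bound for \<open>f\<close> and \<open>g\<close>.

  Conversely, any solution has null coordinates because \<open>((1 + r\<^sup>2) / S)\<^sub>t = (r * q / S)\<^sub>x\<close> with
  \<open>S\<^sup>2 = 1 + r\<^sup>2 - q\<^sup>2\<close>: a potential of this conservation law is strictly increasing in \<open>x\<close> with slope at
  least \<open>1\<close>, so its level sets provide all characteristics without solving a differential equation, and
  the solution is given by the same formulas.
\<close>

subsection \<open>Functions of class \<open>C\<^sup>k\<close>\<close>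

text \<open>Naming \<open>a\<close> and \<open>b\<close> makes the partial derivatives available to
  calculations, where \<open>Ck_on\<close> only asserts that they exist.\<close>

definition has_partials_on ::
    "(real \<times> real \<Rightarrow> real) \<Rightarrow> (real \<times> real \<Rightarrow> real) \<Rightarrow> (real \<times> real \<Rightarrow> real) \<Rightarrow> (real \<times> real) set \<Rightarrow> bool" where
  "has_partials_on u a b S \<longleftrightarrow>
    (\<forall>p\<in>S. (u has_derivative (\<lambda>h. a p * fst h + b p * snd h)) (at p within S))"

declare Ck_on.simps(2) [simp del]

lemma Ck_on_SucE:
  assumes "Ck_on (Suc k) S u"
  obtains a b where "has_partials_on u a b S" "Ck_on k S a" "Ck_on k S b"
  using assms by (auto simp: has_partials_on_def Ck_on.simps(2))

lemma Ck_on_SucI: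
  "has_partials_on u a b S \<Longrightarrow> Ck_on k S a \<Longrightarrow> Ck_on k S b \<Longrightarrow> Ck_on (Suc k) S u"
  by (auto simp: has_partials_on_def Ck_on.simps(2))

lemma has_partials_onD:
  "has_partials_on u a b S \<Longrightarrow> p \<in> S \<Longrightarrow>
    (u has_derivative (\<lambda>h. a p * fst h + b p * snd h)) (at p within S)"
  by (simp add: has_partials_on_def)

lemma has_partials_on_cong:
  assumes "\<And>p. p \<in> S \<Longrightarrow> u p = v p" "\<And>p. p \<in> S \<Longrightarrow> a p = a' p" "\<And>p. p \<in> S \<Longrightarrow> b p = b' p"
  shows "has_partials_on u a b S \<longleftrightarrow> has_partials_on v a' b' S"
  unfolding has_partials_on_def
proof (intro ball_cong refl)
  fix p assume p: "p \<in> S"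
  show "(u has_derivative (\<lambda>h. a p * fst h + b p * snd h)) (at p within S) \<longleftrightarrow>
    (v has_derivative (\<lambda>h. a' p * fst h + b' p * snd h)) (at p within S)"
    using has_derivative_transform[OF p, of u v] has_derivative_transform[OF p, of v u] assms p
    by auto
qed

lemma has_partials_on_imp_continuous_on: "has_partials_on u a b S \<Longrightarrow> continuous_on S u"
  by (auto simp: has_partials_on_def continuous_on_eq_continuous_within
      intro: has_derivative_continuous)

lemma Ck_on_cong:
  assumes "\<And>p. p \<in> S \<Longrightarrow> u p = v p"
  shows "Ck_on k S u \<longleftrightarrow> Ck_on k S v"
proof (cases k)
  case 0
  then show ?thesis using continuous_on_cong[of S S u v] assms by simp
next
  case (Suc n)
  then show ?thesis
    using has_partials_on_cong[of S u v] assms by (metis Ck_on_SucE Ck_on_SucI)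
qed

lemma Ck_on_imp_continuous_on: "Ck_on k S u \<Longrightarrow> continuous_on S u"
  by (cases k) (auto elim: Ck_on_SucE intro: has_partials_on_imp_continuous_on)

lemma Ck_on_SucD: "Ck_on (Suc k) S u \<Longrightarrow> Ck_on k S u"
proof (induction k arbitrary: u)
  case 0
  then show ?case using Ck_on_imp_continuous_on by simp
next
  case (Suc k)
  from Suc.prems show ?case
    by (rule Ck_on_SucE) (rule Ck_on_SucI, auto intro: Suc.IH)
qed

lemma Ck_on_const [simp, intro]: "Ck_on k S (\<lambda>p. c)"
proof (induction k arbitrary: c)
  case (Suc k)
  have "has_partials_on (\<lambda>p. c) (\<lambda>p. 0) (\<lambda>p. 0) S"
    by (simp add: has_partials_on_def)
  then show ?case by (rule Ck_on_SucI) (rule Suc.IH)+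
qed simp

lemma Ck_on_fst [simp, intro]: "Ck_on k S fst"
proof (cases k)
  case (Suc n)
  have "has_partials_on fst (\<lambda>p. 1) (\<lambda>p. 0) S"
    unfolding has_partials_on_def by (auto intro!: derivative_eq_intros)
  then show ?thesis unfolding Suc by (rule Ck_on_SucI) auto
qed (auto intro: continuous_intros)

lemma has_partials_on_add:
  assumes "has_partials_on u a b S" "has_partials_on v c d S"
  shows "has_partials_on (\<lambda>p. u p + v p) (\<lambda>p. a p + c p) (\<lambda>p. b p + d p) S"
  unfolding has_partials_on_def
  by (auto intro!: derivative_eq_intros has_partials_onD[OF assms(1)] has_partials_onD[OF assms(2)]
      simp: algebra_simps)

lemma has_partials_on_mult:
  assumes "has_partials_on u a b S" "has_partials_on v c d S"
  shows "has_partials_on (\<lambda>p. u p * v p) (\<lambda>p. a p * v p + u p * c p) (\<lambda>p. b p * v p + u p * d p) S"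
  unfolding has_partials_on_def
  by (auto intro!: derivative_eq_intros has_partials_onD[OF assms(1)] has_partials_onD[OF assms(2)]
      simp: algebra_simps)

lemma has_partials_on_compose:
  assumes "has_partials_on u a b S" "\<And>p. p \<in> S \<Longrightarrow> (f has_real_derivative f' (u p)) (at (u p))"
  shows "has_partials_on (\<lambda>p. f (u p)) (\<lambda>p. f' (u p) * a p) (\<lambda>p. f' (u p) * b p) S"
  unfolding has_partials_on_def
proof
  fix p assume p: "p \<in> S"
  have "((\<lambda>p. f (u p)) has_derivative (\<lambda>h. f' (u p) * (a p * fst h + b p * snd h))) (at p within S)"
    by (rule has_derivative_compose[OF has_partials_onD[OF assms(1) p]])
      (use assms(2)[OF p] in \<open>simp add: has_field_derivative_def\<close>)
  then show "((\<lambda>p. f (u p)) has_derivative (\<lambda>h. f' (u p) * a p * fst h + f' (u p) * b p * snd h)) (at p within S)"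
    by (simp add: algebra_simps)
qed

lemma Ck_on_add:
  assumes "Ck_on k S u" "Ck_on k S v" shows "Ck_on k S (\<lambda>p. u p + v p)"
  using assms
proof (induction k arbitrary: u v)
  case 0
  then show ?case by (auto intro: continuous_intros)
next
  case (Suc k)
  obtain a b where 1: "has_partials_on u a b S" "Ck_on k S a" "Ck_on k S b"
    using Suc.prems(1) by (rule Ck_on_SucE)
  obtain c d where 2: "has_partials_on v c d S" "Ck_on k S c" "Ck_on k S d"
    using Suc.prems(2) by (rule Ck_on_SucE)
  show ?case
    by (rule Ck_on_SucI[OF has_partials_on_add[OF 1(1) 2(1)]]) (use 1 2 Suc.IH in auto)
qed

lemma Ck_on_mult:
  assumes "Ck_on k S u" "Ck_on k S v" shows "Ck_on k S (\<lambda>p. u p * v p)"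
  using assms
proof (induction k arbitrary: u v)
  case 0
  then show ?case by (auto intro: continuous_intros)
next
  case (Suc k)
  note uv = Ck_on_SucD[OF Suc.prems(1)] Ck_on_SucD[OF Suc.prems(2)]
  obtain a b where 1: "has_partials_on u a b S" "Ck_on k S a" "Ck_on k S b"
    using Suc.prems(1) by (rule Ck_on_SucE)
  obtain c d where 2: "has_partials_on v c d S" "Ck_on k S c" "Ck_on k S d"
    using Suc.prems(2) by (rule Ck_on_SucE)
  show ?case
    by (rule Ck_on_SucI[OF has_partials_on_mult[OF 1(1) 2(1)]])
      (use uv 1 2 in \<open>auto intro!: Ck_on_add Suc.IH\<close>)
qed

lemma Ck_on_minus: "Ck_on k S u \<Longrightarrow> Ck_on k S (\<lambda>p. - u p)"
  using Ck_on_mult[OF Ck_on_const[of k S "-1"], of u] by simp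

lemma Ck_on_diff: "Ck_on k S u \<Longrightarrow> Ck_on k S v \<Longrightarrow> Ck_on k S (\<lambda>p. u p - v p)"
  using Ck_on_add[OF _ Ck_on_minus, of k S u v] by simp

text \<open>The derivative of \<open>1 / u\<close> is \<open>- u' / u\<^sup>2\<close>, again a
  product involving \<open>1 / u\<close>, whose class is supplied by the induction hypothesis for
  the same \<open>u\<close>.\<close>

lemma Ck_on_inverse:
  assumes "Ck_on k S u" "\<And>p. p \<in> S \<Longrightarrow> u p \<noteq> 0" shows "Ck_on k S (\<lambda>p. inverse (u p))"
  using assms
proof (induction k arbitrary: u)
  case 0
  then show ?case by (auto intro: continuous_intros)
next
  case (Suc k)
  obtain a b where 1: "has_partials_on u a b S" "Ck_on k S a" "Ck_on k S b"
    using Suc.prems(1) by (rule Ck_on_SucE)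
  have D: "(inverse has_real_derivative - (inverse (u p) * inverse (u p))) (at (u p))" if "p \<in> S" for p
    using DERIV_inverse[of "u p" UNIV] Suc.prems(2)[OF that] by simp
  have 3: "Ck_on k S (\<lambda>p. inverse (u p))"
    using Suc Ck_on_SucD by blast
  show ?case
    by (rule Ck_on_SucI, rule has_partials_on_compose[OF 1(1) D]) (assumption, (rule Ck_on_mult Ck_on_minus 3 1)+)
qed

lemma Ck_on_divide:
  assumes "Ck_on k S u" "Ck_on k S v" "\<And>p. p \<in> S \<Longrightarrow> v p \<noteq> 0"
  shows "Ck_on k S (\<lambda>p. u p / v p)"
  unfolding divide_inverse using assms by (intro Ck_on_mult Ck_on_inverse)

text \<open>As for the reciprocal, the derivative of the root is expressed by the root
  itself.\<close>

lemma Ck_on_sqrt: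
  assumes "Ck_on k S u" "\<And>p. p \<in> S \<Longrightarrow> u p > 0" shows "Ck_on k S (\<lambda>p. sqrt (u p))"
  using assms
proof (induction k arbitrary: u)
  case 0
  then show ?case by (auto intro: continuous_intros)
next
  case (Suc k)
  obtain a b where 1: "has_partials_on u a b S" "Ck_on k S a" "Ck_on k S b"
    using Suc.prems(1) by (rule Ck_on_SucE)
  have D: "(sqrt has_real_derivative inverse (sqrt (u p)) / 2) (at (u p))" if "p \<in> S" for p
    using DERIV_real_sqrt[OF Suc.prems(2)[OF that]] by simp
  have "Ck_on k S (\<lambda>p. sqrt (u p))"
    using Suc Ck_on_SucD by blast
  then have 3: "Ck_on k S (\<lambda>p. inverse (sqrt (u p)) / 2)"
    by (intro Ck_on_divide Ck_on_inverse) (use Suc.prems(2) in \<open>force+\<close>)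
  show ?case
    by (rule Ck_on_SucI, rule has_partials_on_compose[OF 1(1) D]) (assumption, (rule Ck_on_mult 3 1)+)
qed

section \<open>Functions of class \<open>C\<^sup>k\<close> of one real variable\<close>

text \<open>A function of one variable is read as a function on the plane, so that all closure rules
  are inherited from \<open>Ck_on\<close>.\<close>

definition Ck :: "nat \<Rightarrow> (real \<Rightarrow> real) \<Rightarrow> bool" where
  "Ck k f \<longleftrightarrow> Ck_on k UNIV (\<lambda>p. f (fst p))"

lemma Ck_0: "Ck 0 f \<longleftrightarrow> continuous_on UNIV f"
proof
  assume "Ck 0 f"
  then have "continuous_on UNIV (\<lambda>x. (\<lambda>p. f (fst p)) (x, 0::real))"
    unfolding Ck_def Ck_on.simps
    by (rule continuous_on_compose2[of UNIV "\<lambda>p. f (fst p)"]) (auto intro: continuous_intros)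
  then show "continuous_on UNIV f" by simp
next
  assume "continuous_on UNIV f"
  then show "Ck 0 f"
    unfolding Ck_def Ck_on.simps
    by (rule continuous_on_compose2[of UNIV f]) (auto intro: continuous_intros)
qed

lemma Ck_Suc: "Ck (Suc k) f \<longleftrightarrow> (\<exists>f'. (\<forall>x. (f has_real_derivative f' x) (at x)) \<and> Ck k f')"
proof
  assume "Ck (Suc k) f"
  then obtain a b where ab: "has_partials_on (\<lambda>p. f (fst p)) a b UNIV" "Ck_on k UNIV a" "Ck_on k UNIV b"
    unfolding Ck_def by (rule Ck_on_SucE)
  have D: "(f has_real_derivative a (x, y)) (at x)" for x y
  proof -
    have "((\<lambda>p. f (fst p)) has_derivative (\<lambda>h. a (x,y) * fst h + b (x,y) * snd h)) (at (x,y))"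
      using ab(1) by (simp add: has_partials_on_def)
    moreover have "((\<lambda>z. (z, y)) has_derivative (\<lambda>h. (h, 0))) (at x)"
      by (auto intro!: derivative_eq_intros)
    ultimately have "(f has_derivative (\<lambda>h. a (x,y) * h)) (at x)"
      using has_derivative_compose[of "\<lambda>z. (z, y)" "\<lambda>h. (h, 0)" x UNIV "\<lambda>p. f (fst p)"] by fastforce
    then show ?thesis by (simp add: has_field_derivative_def)
  qed
  \<comment> \<open>The witness \<open>a\<close> might depend on the second coordinate; uniqueness
    of the derivative of \<open>f\<close> rules this out.\<close>
  then have "a p = a (fst p, 0)" for p
    using DERIV_unique[OF D[of "fst p" "snd p"] D[of "fst p" 0]] by simp
  then have "Ck k (\<lambda>x. a (x, 0))"
    unfolding Ck_def using ab(2) by (subst Ck_on_cong[of UNIV _ a]) auto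
  then show "\<exists>f'. (\<forall>x. (f has_real_derivative f' x) (at x)) \<and> Ck k f'"
    using D by (intro exI[of _ "\<lambda>x. a (x, 0)"]) auto
next
  assume "\<exists>f'. (\<forall>x. (f has_real_derivative f' x) (at x)) \<and> Ck k f'"
  then obtain f' where f': "\<And>x. (f has_real_derivative f' x) (at x)" "Ck k f'"
    by blast
  have "has_partials_on fst (\<lambda>p. 1) (\<lambda>p. 0) UNIV"
    unfolding has_partials_on_def by (auto intro!: derivative_eq_intros)
  from has_partials_on_compose[OF this, of f f'] f'
  show "Ck (Suc k) f"
    unfolding Ck_def
    by (intro Ck_on_SucI[of _ "\<lambda>p. f' (fst p)" "\<lambda>p. 0"]) simp_all
qed

lemma Ck_SucI: "(\<And>x. (f has_real_derivative f' x) (at x)) \<Longrightarrow> Ck k f' \<Longrightarrow> Ck (Suc k) f"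
  unfolding Ck_Suc by (intro exI[of _ f']) simp

lemma Ck_SucD: "Ck (Suc k) f \<Longrightarrow> Ck k f"
  unfolding Ck_def by (rule Ck_on_SucD)

lemma Ck_on_compose:
  assumes "Ck k f" "Ck_on k S u" shows "Ck_on k S (\<lambda>p. f (u p))"
  using assms
proof (induction k arbitrary: f u)
  case 0
  then show ?case
    by (auto simp: Ck_0 intro: continuous_on_compose2)
next
  case (Suc k)
  obtain a b where 1: "has_partials_on u a b S" "Ck_on k S a" "Ck_on k S b"
    using Suc.prems(2) by (rule Ck_on_SucE)
  obtain f' where 2: "\<And>x. (f has_real_derivative f' x) (at x)" "Ck k f'"
    using Suc.prems(1) unfolding Ck_Suc by blast
  have "Ck_on k S (\<lambda>p. f' (u p))"
    using Suc 2 Ck_on_SucD by blast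
  then show ?case
    by (intro Ck_on_SucI[OF has_partials_on_compose[OF 1(1) 2(1)]] Ck_on_mult 1)
qed

lemma Ck_compose: "Ck k f \<Longrightarrow> Ck k g \<Longrightarrow> Ck k (\<lambda>x. f (g x))"
  unfolding Ck_def[of k g] Ck_def[of k "\<lambda>x. f (g x)"] by (rule Ck_on_compose)

lemma Ck_add: "Ck k f \<Longrightarrow> Ck k g \<Longrightarrow> Ck k (\<lambda>x. f x + g x)"
  unfolding Ck_def by (rule Ck_on_add)

lemma Ck_diff: "Ck k f \<Longrightarrow> Ck k g \<Longrightarrow> Ck k (\<lambda>x. f x - g x)"
  unfolding Ck_def by (rule Ck_on_diff)

lemma Ck_mult: "Ck k f \<Longrightarrow> Ck k g \<Longrightarrow> Ck k (\<lambda>x. f x * g x)"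
  unfolding Ck_def by (rule Ck_on_mult)

lemma Ck_minus: "Ck k f \<Longrightarrow> Ck k (\<lambda>x. - f x)"
  unfolding Ck_def by (rule Ck_on_minus)

lemma Ck_const: "Ck k (\<lambda>x. c)"
  unfolding Ck_def by (rule Ck_on_const)

lemma Ck_divide: "Ck k f \<Longrightarrow> Ck k g \<Longrightarrow> (\<And>x. g x \<noteq> 0) \<Longrightarrow> Ck k (\<lambda>x. f x / g x)"
  unfolding Ck_def by (rule Ck_on_divide)

lemma Ck_sqrt: "Ck k f \<Longrightarrow> (\<And>x. f x > 0) \<Longrightarrow> Ck k (\<lambda>x. sqrt (f x))"
  unfolding Ck_def by (rule Ck_on_sqrt)

lemma smooth_imp_has_derivative: "smooth f \<Longrightarrow> (f has_real_derivative deriv f x) (at x)"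
  unfolding smooth_def
  by (drule spec[of _ 0]) (simp add: differentiable_on_def DERIV_deriv_iff_real_differentiable)

lemma smooth_deriv: "smooth f \<Longrightarrow> smooth (deriv f)"
  unfolding smooth_def by (metis comp_apply funpow_Suc_right)

lemma smooth_imp_Ck: "smooth f \<Longrightarrow> Ck k f"
proof (induction k arbitrary: f)
  case 0
  then show ?case
    by (metis Ck_0 DERIV_isCont continuous_at_imp_continuous_on smooth_imp_has_derivative)
next
  case (Suc k)
  then show ?case unfolding Ck_Suc using smooth_deriv smooth_imp_has_derivative by blast
qed

subsection \<open>Calculus on the half-plane\<close>

lemma mem_half_plane [simp]: "(t, x) \<in> half_plane \<longleftrightarrow> 0 \<le> t"
  by (simp add: half_plane_def)

text \<open>The curve is a graph over the times \<open>s \<ge> 0\<close>, hence stays in the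
  half-plane, and the chain rule within sets holds up to \<open>t = 0\<close>.\<close>

lemma has_partials_on_curve:
  assumes "has_partials_on u a b half_plane" "0 \<le> t"
    and "(y has_real_derivative y') (at t within {0..})"
  shows "((\<lambda>s. u (s, y s)) has_real_derivative a (t, y t) + b (t, y t) * y') (at t within {0..})"
proof -
  have "((\<lambda>s. (s, y s)) has_derivative (\<lambda>h. (h, y' * h))) (at t within {0..})"
    using assms(3) by (auto intro!: derivative_eq_intros simp: has_field_derivative_def)
  moreover have "(\<lambda>s. (s, y s)) ` {0..} \<subseteq> half_plane"
    by auto
  ultimately have "((\<lambda>s. u (s, y s)) has_derivative (\<lambda>h. a (t, y t) * h + b (t, y t) * (y' * h))) (at t within {0..})"
    using has_derivative_in_compose2[of half_plane u "\<lambda>p h. a p * fst h + b p * snd h" "\<lambda>s. (s, y s)" "{0..}" t "\<lambda>h. (h, y' * h)"]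
      assms(1,2) by (auto simp: has_partials_on_def)
  then show ?thesis
    by (rule has_derivative_imp_has_field_derivative) (simp add: algebra_simps)
qed

lemma has_partials_on_time:
  assumes "has_partials_on u a b half_plane" "0 \<le> t"
  shows "((\<lambda>s. u (s, x)) has_real_derivative a (t, x)) (at t within {0..})"
  using has_partials_on_curve[OF assms, of "\<lambda>s. x" 0] by simp

lemma has_partials_on_space:
  assumes "has_partials_on u a b half_plane" "0 \<le> t"
  shows "((\<lambda>y. u (t, y)) has_real_derivative b (t, x)) (at x)"
proof -
  have "((\<lambda>y. (t, y)) has_derivative (\<lambda>h. (0, h))) (at x)"
    by (auto intro!: derivative_eq_intros)
  moreover have "(\<lambda>y. (t, y)) ` UNIV \<subseteq> half_plane"
    using assms(2) by auto
  ultimately have "((\<lambda>y. u (t, y)) has_derivative (\<lambda>h. b (t, x) * h)) (at x)"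
    using has_derivative_in_compose2[of half_plane u "\<lambda>p h. a p * fst h + b p * snd h" "\<lambda>y. (t, y)" UNIV x "\<lambda>h. (0, h)"]
      assms(1) by (auto simp: has_partials_on_def)
  then show ?thesis by (simp add: has_field_derivative_def)
qed

lemma at_within_atLeast_nontrivial: "(0::real) \<le> t \<Longrightarrow> at t within {0..} \<noteq> bot"
  using trivial_limit_at_right_real[of t] at_le[of "{t<..}" "{0..}" t]
  by (metis atLeast_iff bot.extremum_uniqueI greaterThan_iff less_eq_real_def order_trans subsetI)

lemma DERIV_atLeast_unique:
  assumes "0 \<le> t" "(f has_real_derivative A) (at t within {0..})"
    "(f has_real_derivative B) (at t within {0..})"
  shows "A = B"
  using assms at_within_atLeast_nontrivial vector_derivative_within
  by (metis has_real_derivative_iff_has_vector_derivative)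

lemma dt_eq:
  assumes "has_partials_on u a b half_plane" "p \<in> half_plane"
  shows "dt u p = a p"
  using has_partials_on_time[OF assms(1), of "fst p" "snd p"] assms(2)
    vector_derivative_within[OF at_within_atLeast_nontrivial[of "fst p"]]
  by (auto simp: dt_def half_plane_def has_real_derivative_iff_has_vector_derivative)

lemma dx_eq:
  assumes "has_partials_on u a b half_plane" "p \<in> half_plane"
  shows "dx u p = b p"
  using has_partials_on_space[OF assms(1), of "fst p" "snd p"] assms(2)
  by (auto simp: dx_def half_plane_def intro: DERIV_imp_deriv)

lemma smooth_on_has_partials:
  assumes "smooth_on half_plane u"
  shows "has_partials_on u (dt u) (dx u) half_plane"
proof -
  have "Ck_on (Suc 0) half_plane u"
    using assms unfolding smooth_on_def by blast
  then obtain a b where ab: "has_partials_on u a b half_plane"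
    by (rule Ck_on_SucE)
  show ?thesis
    using ab dt_eq[OF ab] dx_eq[OF ab] by (subst has_partials_on_cong[of _ u u _ a _ b]) auto
qed

text \<open>The witnesses in \<open>Ck_on\<close> may change with \<open>k\<close>, but on the
  half-plane they all agree with \<open>dt u\<close> and \<open>dx u\<close>.\<close>

lemma smooth_on_dt_dx:
  assumes "smooth_on half_plane u"
  shows "smooth_on half_plane (dt u)" "smooth_on half_plane (dx u)"
proof -
  have "Ck_on k half_plane (dt u) \<and> Ck_on k half_plane (dx u)" for k
  proof -
    have "Ck_on (Suc k) half_plane u"
      using assms unfolding smooth_on_def by blast
    then obtain a b where ab: "has_partials_on u a b half_plane"
      "Ck_on k half_plane a" "Ck_on k half_plane b"
      by (rule Ck_on_SucE)
    then show ?thesis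
      using Ck_on_cong[of half_plane "dt u" a k] Ck_on_cong[of half_plane "dx u" b k]
        dt_eq[OF ab(1)] dx_eq[OF ab(1)] by simp
  qed
  then show "smooth_on half_plane (dt u)" "smooth_on half_plane (dx u)"
    by (auto simp: smooth_on_def)
qed

lemma smooth_on_imp_continuous_on: "smooth_on S u \<Longrightarrow> continuous_on S u"
  unfolding smooth_on_def using Ck_on_imp_continuous_on by blast

section \<open>Integration in time, symmetry of mixed derivatives and potentials\<close>

lemma DERIV_atLeast_zero_constant:
  assumes "\<And>t. 0 \<le> t \<Longrightarrow> (f has_real_derivative 0) (at t within {0..})" "0 \<le> t"
  shows "f t = f 0"
proof -
  obtain c where "\<And>t. 0 \<le> t \<Longrightarrow> f t = c"
    using has_field_derivative_zero_constant[of "{0..}" f] assms(1) by auto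
  then show ?thesis using assms(2) by simp
qed

lemma DERIV_atLeast_eq:
  assumes "\<And>t. 0 \<le> t \<Longrightarrow> (f has_real_derivative D t) (at t within {0..})"
    "\<And>t. 0 \<le> t \<Longrightarrow> (g has_real_derivative D t) (at t within {0..})" "0 \<le> t"
  shows "f t - f 0 = g t - g 0"
proof -
  have "((\<lambda>t. f t - g t) has_real_derivative 0) (at t within {0..})" if "0 \<le> t" for t
    using DERIV_diff[OF assms(1,2)[OF that]] by simp
  from DERIV_atLeast_zero_constant[OF this assms(3)] show ?thesis by simp
qed

lemma continuous_on_time_slice:
  assumes "continuous_on half_plane m" shows "continuous_on {0..} (\<lambda>s. m (s, x))"
  by (rule continuous_on_compose2[OF assms]) (auto intro!: continuous_intros)

lemma DERIV_time_integral:
  assumes "continuous_on half_plane m" "0 \<le> t"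
  shows "((\<lambda>t. integral {0..t} (\<lambda>s. m (s, x))) has_real_derivative m (t, x)) (at t within {0..})"
proof -
  have "((\<lambda>t. integral {0..t} (\<lambda>s. m (s, x))) has_real_derivative m (t, x)) (at t within {0..t+1})"
    by (rule integral_has_real_derivative)
      (use assms in \<open>auto intro: continuous_on_subset[OF continuous_on_time_slice]\<close>)
  moreover have "at t within {0..t+1} = at t within {0..}"
    by (rule at_within_nhd[of _ "{..<t+1}"]) auto
  ultimately show ?thesis by simp
qed

lemma DERIV_space_integral:
  assumes "has_partials_on m mt mx half_plane" "continuous_on half_plane mx" "0 \<le> t"
  shows "((\<lambda>x. integral {0..t} (\<lambda>s. m (s, x))) has_real_derivative integral {0..t} (\<lambda>s. mx (s, x))) (at x)"
proof -
  have "((\<lambda>x. integral (cbox 0 t) (\<lambda>s. m (s, x))) has_real_derivative integral (cbox 0 t) (\<lambda>s. mx (s, x))) (at x within UNIV)"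
  proof (rule leibniz_rule_field_derivative)
    show "((\<lambda>x. m (s, x)) has_real_derivative mx (s, x)) (at x)" if "s \<in> cbox 0 t" for s x
      using has_partials_on_space[OF assms(1)] that by auto
    show "(\<lambda>s. m (s, x)) integrable_on cbox 0 t" for x
      unfolding box_real
      by (rule integrable_continuous_interval)
        (auto intro: continuous_on_subset[OF continuous_on_time_slice]
          has_partials_on_imp_continuous_on[OF assms(1)])
    show "continuous_on (UNIV \<times> cbox 0 t) (\<lambda>(x, s). mx (s, x))"
      unfolding split_beta
      by (rule continuous_on_compose2[OF assms(2)]) (auto intro!: continuous_intros)
  qed auto
  then show ?thesis by simp
qed

text \<open>Integrate \<open>u\<^sub>t = a\<close> in time, differentiate in \<open>x\<close> under
  the integral, and differentiate the result in \<open>t\<close>. This works up to the boundary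
  \<open>t = 0\<close>.\<close>

lemma mixed_partials:
  assumes "has_partials_on u a b half_plane" "has_partials_on a at' ax half_plane"
    "has_partials_on b bt bx half_plane" "continuous_on half_plane ax" "p \<in> half_plane"
  shows "bt p = ax p"
proof -
  obtain t x where p: "p = (t, x)" "0 \<le> t"
    using assms(5) by (cases p) auto
  have u: "u (t, x) = u (0, x) + integral {0..t} (\<lambda>s. a (s, x))" if "0 \<le> t" for t x
    using DERIV_atLeast_eq[of "\<lambda>t. u (t, x)" "\<lambda>t. a (t, x)" "\<lambda>t. integral {0..t} (\<lambda>s. a (s, x))"]
      has_partials_on_time[OF assms(1)] DERIV_time_integral[OF has_partials_on_imp_continuous_on[OF assms(2)]] that
    by fastforce
  have b: "b (t, x) = b (0, x) + integral {0..t} (\<lambda>s. ax (s, x))" if "0 \<le> t" for t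
  proof -
    have "((\<lambda>x. u (t, x)) has_real_derivative b (0, x) + integral {0..t} (\<lambda>s. ax (s, x))) (at x)"
      unfolding u[OF that]
      by (intro DERIV_add has_partials_on_space[OF assms(1)] DERIV_space_integral[OF assms(2,4)] that order_refl)
    then show ?thesis
      using DERIV_unique has_partials_on_space[OF assms(1) that] by blast
  qed
  have "((\<lambda>s. b (0, x) + integral {0..s} (\<lambda>s. ax (s, x))) has_real_derivative ax (t, x)) (at t within {0..})"
    using DERIV_add[OF DERIV_const DERIV_time_integral[OF assms(4) p(2), of x]] by simp
  then have "((\<lambda>s. b (s, x)) has_real_derivative ax (t, x)) (at t within {0..})"
    by (rule has_field_derivative_transform_within[OF _ zero_less_one]) (use p in \<open>simp_all add: b[symmetric]\<close>)
  then show ?thesis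
    unfolding p(1) by (rule DERIV_atLeast_unique[OF p(2) has_partials_on_time[OF assms(3) p(2)]])
qed

text \<open>The form \<open>m dt + e dx\<close> is closed, since the time derivative of
  \<open>e\<close> is the space derivative \<open>mx\<close> of \<open>m\<close>. Its potential is
  found by integrating \<open>m\<close> in time from an antiderivative \<open>h0\<close> of
  \<open>e\<close> at \<open>t = 0\<close>.\<close>

lemma has_partials_on_potential:
  assumes m: "has_partials_on m mt mx half_plane" and e: "has_partials_on e mx ex half_plane"
    and mx: "continuous_on half_plane mx"
    and h0: "\<And>x. (h0 has_real_derivative e (0, x)) (at x)"
  shows "has_partials_on (\<lambda>p. h0 (snd p) + integral {0..fst p} (\<lambda>s. m (s, snd p))) m e half_plane"
  unfolding has_partials_on_def
proof
  fix p assume "p \<in> half_plane"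
  then obtain t x where p: "p = (t, x)" "0 \<le> t"
    by (cases p) auto
  note cm = has_partials_on_imp_continuous_on[OF m]
  note ce = has_partials_on_imp_continuous_on[OF e]
  have E: "e (t, y) = e (0, y) + integral {0..t} (\<lambda>s. mx (s, y))" if "0 \<le> t" for t y
    using DERIV_atLeast_eq[of "\<lambda>t. e (t, y)" "\<lambda>t. mx (t, y)" "\<lambda>t. integral {0..t} (\<lambda>s. mx (s, y))"]
      has_partials_on_time[OF e] DERIV_time_integral[OF mx] that
    by fastforce
  let ?H = "\<lambda>t y. h0 y + integral {0..t} (\<lambda>s. m (s, y))"
  have Ht: "((\<lambda>t. ?H t x) has_derivative (*) (m (t, x))) (at t within {0..})"
    using DERIV_add[OF DERIV_const DERIV_time_integral[OF cm p(2), of x]]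
    by (simp add: has_field_derivative_def)
  have Hx: "((\<lambda>y. ?H s y) has_derivative blinfun_apply (blinfun_mult_right (e (s, y)))) (at y within UNIV)"
    if "s \<in> {0..}" for s y
    using DERIV_add[OF h0 DERIV_space_integral[OF m mx], of s y] E[of s y] that
    by (simp add: has_field_derivative_def)
  \<comment> \<open>Differentiability in both variables jointly needs the space derivative to be
    continuous as a map into linear operators.\<close>
  have "((\<lambda>q. blinfun_mult_right (e q)) \<longlongrightarrow> blinfun_mult_right (e (t, x))) (at (t, x) within half_plane)"
    by (intro bounded_linear.tendsto[OF bounded_linear_blinfun_mult_right])
      (use ce p in \<open>simp add: continuous_on_def\<close>)
  then have lim: "continuous (at (t, x) within {0..} \<times> UNIV) (\<lambda>(t, y). blinfun_mult_right (e (t, y)))"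
    by (simp add: half_plane_def case_prod_unfold continuous_within)
  have "((\<lambda>(t, y). ?H t y) has_derivative (\<lambda>(s, y). m (t, x) * s + blinfun_apply (blinfun_mult_right (e (t, x))) y))
     (at (t, x) within {0..} \<times> UNIV)"
    by (rule has_derivative_partialsI[where fy = "\<lambda>s y. blinfun_mult_right (e (s, y))", OF Ht Hx lim]) auto
  then show "((\<lambda>p. h0 (snd p) + integral {0..fst p} (\<lambda>s. m (s, snd p))) has_derivative
          (\<lambda>h. m p * fst h + e p * snd h)) (at p within half_plane)"
    unfolding half_plane_def p(1) by (simp add: case_prod_unfold)
qed

section \<open>Inversion in the space variable and autonomous flows\<close>

text \<open>At each time, \<open>H\<close> increases in space with slope at least \<open>c\<close>,
  hence is a bijection of the line. The curves \<open>t \<mapsto> \<Xi> (t, z)\<close> are the level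
  sets of \<open>H\<close>, and \<open>- a / b\<close> is their speed by implicit
  differentiation.\<close>

lemma slice_inverse:
  assumes H: "has_partials_on H a b half_plane" and c: "0 < c"
    and b: "\<And>p. p \<in> half_plane \<Longrightarrow> c \<le> b p"
  obtains \<Xi> where "\<And>t z. 0 \<le> t \<Longrightarrow> H (t, \<Xi> (t, z)) = z"
    "\<And>t y. 0 \<le> t \<Longrightarrow> \<Xi> (t, H (t, y)) = y"
    "has_partials_on \<Xi> (\<lambda>p. - a (fst p, \<Xi> p) / b (fst p, \<Xi> p)) (\<lambda>p. 1 / b (fst p, \<Xi> p)) half_plane"
proof -
  have expand: "c * (y - x) \<le> H (t, y) - H (t, x)" if "x \<le> y" "0 \<le> t" for t x y
  proof -
    have "((\<lambda>y. H (t, y) - c * y) has_real_derivative b (t, y) - c) (at y)" for y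
      using has_partials_on_space[OF H that(2)] by (auto intro!: derivative_eq_intros)
    then have "H (t, x) - c * x \<le> H (t, y) - c * y"
      using b that by (intro DERIV_nonneg_imp_nondecreasing[OF that(1)]) force
    then show ?thesis by (simp add: algebra_simps)
  qed
  have lip: "c * \<bar>y - x\<bar> \<le> \<bar>H (t, y) - H (t, x)\<bar>" if "0 \<le> t" for t x y
    using expand[OF _ that, of x y] expand[OF _ that, of y x] by (cases x y rule: linorder_cases) auto
  have inj: "x = y" if "0 \<le> t" "H (t, x) = H (t, y)" for t x y
    using lip[OF that(1), of x y] that(2) c by (simp add: mult_le_0_iff)
  have surj: "\<exists>y. H (t, y) = z" if t: "0 \<le> t" for t z
  proof -
    \<comment> \<open>The slope bound moves \<open>H (t, \<cdot>)\<close> by at least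
      \<open>c * r\<close> over a distance \<open>r\<close>, so \<open>z\<close> is enclosed on
      \<open>[-r, r]\<close>.\<close>
    define r where "r = \<bar>z - H (t, 0)\<bar> / c"
    have "r \<ge> 0" "c * r = \<bar>z - H (t, 0)\<bar>"
      using c by (auto simp: r_def)
    then have "H (t, - r) \<le> z" "z \<le> H (t, r)"
      using expand[OF _ t, of 0 r] expand[OF _ t, of "-r" 0] by auto
    moreover have "isCont (\<lambda>y. H (t, y)) y" for y
      using has_partials_on_space[OF H t] DERIV_isCont by blast
    ultimately show ?thesis
      using IVT[of "\<lambda>y. H (t, y)" "- r" z r] \<open>r \<ge> 0\<close> by auto
  qed
  define \<Xi> where "\<Xi> p = (SOME y. H (fst p, y) = snd p)" for p
  have HX: "H (t, \<Xi> (t, z)) = z" if "0 \<le> t" for t z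
    using someI_ex[OF surj[OF that, of z]] by (simp add: \<Xi>_def)
  have XH: "\<Xi> (t, H (t, y)) = y" if "0 \<le> t" for t y
    using inj[OF that] HX[OF that] by blast
  \<comment> \<open>\<open>T\<close> maps the half-plane onto itself, so the inverse rule within
    sets applies up to the boundary.\<close>
  define T where "T p = (fst p, H p)" for p
  have T_img: "T ` half_plane = half_plane"
  proof -
    have "p \<in> T ` half_plane" if "p \<in> half_plane" for p
      using that HX[of "fst p" "snd p"] by (intro image_eqI[of _ _ "(fst p, \<Xi> p)"]) (auto simp: T_def half_plane_def)
    then show ?thesis by (auto simp: T_def half_plane_def)
  qed
  have cont: "continuous_on half_plane \<Xi>"
    unfolding continuous_on_def
  proof
    fix q assume q: "q \<in> half_plane"
    obtain t z where tz: "q = (t, z)" "0 \<le> t" using q by (cases q) auto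
    let ?F = "at q within half_plane"
    have cH: "((\<lambda>p. H (fst p, \<Xi> q)) \<longlongrightarrow> H (fst q, \<Xi> q)) ?F"
    proof -
      have "continuous_on half_plane (\<lambda>p. H (fst p, \<Xi> q))"
        by (rule continuous_on_compose2[OF has_partials_on_imp_continuous_on[OF H]])
          (auto intro!: continuous_intros simp: half_plane_def)
      then show ?thesis using q by (simp add: continuous_on_def)
    qed
    \<comment> \<open>Squeeze: \<open>lip\<close> at the time of \<open>p\<close> bounds the change
      of \<open>\<Xi>\<close> by this quantity, in which only the fixed point \<open>\<Xi> q\<close>
      occurs.\<close>
    have "((\<lambda>p. \<bar>snd p - H (fst p, \<Xi> q)\<bar> / c) \<longlongrightarrow> \<bar>snd q - H (fst q, \<Xi> q)\<bar> / c) ?F"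
      using c by (intro tendsto_intros cH) auto
    then have "((\<lambda>p. \<bar>snd p - H (fst p, \<Xi> q)\<bar> / c) \<longlongrightarrow> 0) ?F"
      using HX[OF tz(2)] tz(1) by simp
    moreover have "eventually (\<lambda>p. norm (\<Xi> p - \<Xi> q) \<le> \<bar>snd p - H (fst p, \<Xi> q)\<bar> / c) ?F"
      unfolding eventually_at_filter
    proof (intro always_eventually allI impI)
      fix p :: "real \<times> real" assume p: "p \<in> half_plane"
      obtain t' z' where "p = (t', z')" "0 \<le> t'" using p by (cases p) auto
      then show "norm (\<Xi> p - \<Xi> q) \<le> \<bar>snd p - H (fst p, \<Xi> q)\<bar> / c"
        using lip[of t' "\<Xi> p" "\<Xi> q"] HX[of t' z'] c by (simp add: field_simps)
    qed
    ultimately have "((\<lambda>p. \<Xi> p - \<Xi> q) \<longlongrightarrow> 0) ?F"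
      by (rule Lim_null_comparison[rotated])
    then show "(\<Xi> \<longlongrightarrow> \<Xi> q) ?F"
      by (simp add: LIM_zero_iff)
  qed
  have "has_partials_on \<Xi> (\<lambda>p. - a (fst p, \<Xi> p) / b (fst p, \<Xi> p)) (\<lambda>p. 1 / b (fst p, \<Xi> p)) half_plane"
    unfolding has_partials_on_def
  proof
    fix q assume q: "q \<in> half_plane"
    then obtain t z where tz: "q = (t, z)" "0 \<le> t" by (cases q) auto
    define p where "p = (t, \<Xi> q)"
    have p: "p \<in> half_plane" "T p = q"
      using tz HX by (auto simp: p_def T_def)
    have bp: "b p > 0" using b[OF p(1)] c by simp
    let ?T' = "\<lambda>h. (fst h, a p * fst h + b p * snd h)"
    let ?G' = "\<lambda>h. (fst h, - a p / b p * fst h + 1 / b p * snd h)"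
    have T': "(T has_derivative ?T') (at p within half_plane)"
      unfolding T_def[abs_def] by (auto intro!: derivative_eq_intros has_partials_onD[OF H p(1)])
    have "((\<lambda>p. (fst p, \<Xi> p)) has_derivative ?G') (at (T p) within T ` half_plane)"
    proof (rule has_derivative_inverse_within[OF T'])
      show "continuous (at (T p) within T ` half_plane) (\<lambda>p. (fst p, \<Xi> p))"
        unfolding T_img p(2) using cont q
        by (auto intro!: continuous_intros simp: continuous_on_eq_continuous_within)
      show "linear ?G'"
        by (auto intro!: linearI simp: algebra_simps add_divide_distrib diff_divide_distrib)
      show "?G' \<circ> ?T' = id"
        using bp by (auto simp: fun_eq_iff field_simps)
      show "(fst (T x), \<Xi> (T x)) = x" if "x \<in> half_plane" for x
        using that XH[of "fst x" "snd x"] by (cases x) (auto simp: T_def)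
    qed (use p in auto)
    then have "((\<lambda>p. (fst p, \<Xi> p)) has_derivative ?G') (at q within half_plane)"
      unfolding T_img p(2) .
    from has_derivative_snd[OF this]
    show "(\<Xi> has_derivative (\<lambda>h. - a (fst q, \<Xi> q) / b (fst q, \<Xi> q) * fst h + 1 / b (fst q, \<Xi> q) * snd h)) (at q within half_plane)"
      by (simp add: p_def tz)
  qed
  with HX XH show thesis by (rule that)
qed

lemma antiderivative:
  fixes f :: "real \<Rightarrow> real"
  assumes "continuous_on UNIV f"
  obtains A where "\<And>x. (A has_real_derivative f x) (at x)"
proof
  fix x :: real
  let ?A = "\<lambda>x. LBINT y=ereal 0..ereal x. f y"
  \<comment> \<open>The interval contains \<open>0\<close> and has \<open>x\<close> in its interior,
    so the derivative within it is the full derivative.\<close>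
  have "(?A has_vector_derivative f x) (at x within {- \<bar>x\<bar> - 1 .. \<bar>x\<bar> + 1})"
    by (rule interval_integral_FTC2) (auto intro: continuous_on_subset[OF assms])
  then show "(?A has_real_derivative f x) (at x)"
    by (simp add: has_real_derivative_iff_has_vector_derivative at_within_Icc_at)
qed

text \<open>Separation of variables: \<open>s\<close> is the inverse of the travel time
  \<open>a\<close>. The bound \<open>W x \<le> C\<close> keeps the slope of \<open>a\<close> above
  \<open>1 / C\<close>, so the flow exists for all parameters.\<close>

lemma inverse_flow:
  assumes W: "continuous_on UNIV W" and bounds: "\<And>x. 0 < W x" "\<And>x. W x \<le> C"
  obtains a s where "\<And>x. (a has_real_derivative 1 / W x) (at x)"
    "\<And>y. (s has_real_derivative W (s y)) (at y)" "\<And>y. a (s y) = y" "\<And>x. s (a x) = x"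
proof -
  have "continuous_on UNIV (\<lambda>x. 1 / W x)"
    using W bounds(1) by (intro continuous_intros) (auto simp: less_le)
  then obtain a where a: "\<And>x. (a has_real_derivative 1 / W x) (at x)"
    by (rule antiderivative) blast
  \<comment> \<open>\<open>a\<close> is extended to the half-plane independently of time, and the
    inverse is read off at time \<open>0\<close>.\<close>
  have "has_partials_on snd (\<lambda>p. 0) (\<lambda>p. 1) half_plane"
    unfolding has_partials_on_def by (auto intro!: derivative_eq_intros)
  from has_partials_on_compose[OF this a]
  have H: "has_partials_on (\<lambda>p. a (snd p)) (\<lambda>p. 0) (\<lambda>p. 1 / W (snd p)) half_plane"
    by simp
  have C: "0 < 1 / C" "1 / C \<le> 1 / W (snd p)" for p :: "real \<times> real"
    using bounds(1)[of 0] bounds(2)[of 0] bounds[of "snd p"] by (auto intro!: divide_left_mono)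
  obtain \<Xi> where \<Xi>: "\<And>t z. 0 \<le> t \<Longrightarrow> a (\<Xi> (t, z)) = z" "\<And>t y. 0 \<le> t \<Longrightarrow> \<Xi> (t, a y) = y"
    "has_partials_on \<Xi> (\<lambda>p. - 0 / (1 / W (\<Xi> p))) (\<lambda>p. 1 / (1 / W (\<Xi> p))) half_plane"
    by (rule slice_inverse[OF H C]) auto
  show thesis
    using has_partials_on_space[OF \<Xi>(3), of 0]
    by (intro that[of a "\<lambda>y. \<Xi> (0, y)"] a) (simp_all add: \<Xi>)
qed

section \<open>Closure rules for smooth functions and their partial derivatives\<close>

lemma smooth_on_const: "smooth_on S (\<lambda>p. c)"
  by (auto simp: smooth_on_def)

lemma smooth_on_add: "smooth_on S u \<Longrightarrow> smooth_on S v \<Longrightarrow> smooth_on S (\<lambda>p. u p + v p)"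
  and smooth_on_diff: "smooth_on S u \<Longrightarrow> smooth_on S v \<Longrightarrow> smooth_on S (\<lambda>p. u p - v p)"
  and smooth_on_mult: "smooth_on S u \<Longrightarrow> smooth_on S v \<Longrightarrow> smooth_on S (\<lambda>p. u p * v p)"
  by (simp_all add: smooth_on_def Ck_on_add Ck_on_diff Ck_on_mult)

lemma smooth_on_divide:
  "smooth_on S u \<Longrightarrow> smooth_on S v \<Longrightarrow> (\<And>p. p \<in> S \<Longrightarrow> v p \<noteq> 0) \<Longrightarrow> smooth_on S (\<lambda>p. u p / v p)"
  by (simp add: smooth_on_def Ck_on_divide)

lemma smooth_on_sqrt:
  "smooth_on S u \<Longrightarrow> (\<And>p. p \<in> S \<Longrightarrow> u p > 0) \<Longrightarrow> smooth_on S (\<lambda>p. sqrt (u p))"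
  by (simp add: smooth_on_def Ck_on_sqrt)

lemma smooth_on_compose: "(\<And>k. Ck k f) \<Longrightarrow> smooth_on S u \<Longrightarrow> smooth_on S (\<lambda>p. f (u p))"
  by (simp add: smooth_on_def Ck_on_compose)

lemma smooth_on_power2: "smooth_on S u \<Longrightarrow> smooth_on S (\<lambda>p. (u p)\<^sup>2)"
  unfolding power2_eq_square by (rule smooth_on_mult)

lemmas smooth_on_intros = smooth_on_const smooth_on_add smooth_on_diff smooth_on_mult
  smooth_on_divide smooth_on_sqrt smooth_on_power2

text \<open>Identities known only on the half-plane may thus be differentiated there.\<close>

lemma partials_cong:
  assumes "smooth_on half_plane u" "\<And>p. p \<in> half_plane \<Longrightarrow> u p = v p" "p \<in> half_plane"
  shows "dt u p = dt v p" "dx u p = dx v p"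
proof -
  have "has_partials_on v (dt u) (dx u) half_plane"
    using smooth_on_has_partials[OF assms(1)] has_partials_on_cong[of half_plane u v "dt u" "dt u" "dx u" "dx u"]
      assms(2) by auto
  then show "dt u p = dt v p" "dx u p = dx v p"
    using dt_eq dx_eq assms(3) by metis+
qed

lemma partials_add:
  assumes "smooth_on half_plane u" "smooth_on half_plane v" "p \<in> half_plane"
  shows "dt (\<lambda>p. u p + v p) p = dt u p + dt v p" "dx (\<lambda>p. u p + v p) p = dx u p + dx v p"
  using has_partials_on_add[OF smooth_on_has_partials[OF assms(1)] smooth_on_has_partials[OF assms(2)]]
  by (simp_all add: dt_eq dx_eq assms(3))

lemma partials_mult:
  assumes "smooth_on half_plane u" "smooth_on half_plane v" "p \<in> half_plane"
  shows "dt (\<lambda>p. u p * v p) p = dt u p * v p + u p * dt v p"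
    "dx (\<lambda>p. u p * v p) p = dx u p * v p + u p * dx v p"
  using has_partials_on_mult[OF smooth_on_has_partials[OF assms(1)] smooth_on_has_partials[OF assms(2)]]
  by (simp_all add: dt_eq dx_eq assms(3))

lemma partials_const:
  assumes "p \<in> half_plane" shows "dt (\<lambda>p. c) p = 0" "dx (\<lambda>p. c) p = 0"
proof -
  have "has_partials_on (\<lambda>p. c) (\<lambda>p. 0) (\<lambda>p. 0) half_plane"
    by (simp add: has_partials_on_def)
  then show "dt (\<lambda>p. c) p = 0" "dx (\<lambda>p. c) p = 0"
    using dt_eq dx_eq assms by metis+
qed

lemma dt_dx_commute:
  assumes "smooth_on half_plane u" "p \<in> half_plane"
  shows "dt (dx u) p = dx (dt u) p"
  using mixed_partials[OF smooth_on_has_partials[OF assms(1)] smooth_on_has_partials smooth_on_has_partials]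
    smooth_on_dt_dx smooth_on_imp_continuous_on assms by blast

subsection \<open>The quasilinear equation and its characteristic speeds\<close>

text \<open>The area element of the graph of \<open>u\<close> in Minkowski space, for which the
  string equation is the Euler-Lagrange equation.\<close>

definition area_density :: "(real \<times> real \<Rightarrow> real) \<Rightarrow> real \<times> real \<Rightarrow> real" where
  "area_density u p = sqrt (1 + (dx u p)\<^sup>2 - (dt u p)\<^sup>2)"

lemma area_density:
  assumes "timelike u" "p \<in> half_plane"
  shows "0 < area_density u p" "(area_density u p)\<^sup>2 = 1 + (dx u p)\<^sup>2 - (dt u p)\<^sup>2"
  using assms by (auto simp: area_density_def timelike_def less_imp_le)

lemma smooth_area_density:
  assumes "smooth_on half_plane u" "timelike u"
  shows "smooth_on half_plane (area_density u)"
  unfolding area_density_def[abs_def]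
  by (intro smooth_on_intros smooth_on_dt_dx assms(1)) (use assms(2) in \<open>auto simp: timelike_def\<close>)

text \<open>Differentiate the polynomial identity
  \<open>S\<^sup>2 + q\<^sup>2 = 1 + r\<^sup>2\<close>; the square root itself is never
  differentiated.\<close>

lemma partials_area_density:
  assumes "smooth_on half_plane u" "timelike u" "p \<in> half_plane"
  shows "area_density u p * dt (area_density u) p = dx u p * dx (dt u) p - dt u p * dt (dt u) p"
    "area_density u p * dx (area_density u) p = dx u p * dx (dx u) p - dt u p * dx (dt u) p"
proof -
  note sm = smooth_on_dt_dx[OF assms(1)] smooth_area_density[OF assms(1,2)]
  define l where "l = (\<lambda>q. area_density u q * area_density u q + dt u q * dt u q)"
  define r where "r = (\<lambda>q. 1 + dx u q * dx u q)"
  have "smooth_on half_plane l"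
    unfolding l_def by (intro smooth_on_intros sm)
  moreover have "l q = r q" if "q \<in> half_plane" for q
    using area_density(2)[OF assms(2) that] by (simp add: l_def r_def power2_eq_square)
  ultimately have "dt l p = dt r p" "dx l p = dx r p"
    using partials_cong assms(3) by metis+
  then show "area_density u p * dt (area_density u) p = dx u p * dx (dt u) p - dt u p * dt (dt u) p"
    "area_density u p * dx (area_density u) p = dx u p * dx (dx u) p - dt u p * dx (dt u) p"
    using dt_dx_commute[OF assms(1,3)]
    by (simp_all add: l_def r_def partials_add partials_mult partials_const smooth_on_intros sm assms(3) algebra_simps)
qed

text \<open>The string equation in nondivergence form, multiplied by the cube of the area
  density.\<close>

definition string_operator :: "(real \<times> real \<Rightarrow> real) \<Rightarrow> real \<times> real \<Rightarrow> real" where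
  "string_operator u p = (1 + (dx u p)\<^sup>2) * dt (dt u) p - 2 * dx u p * dt u p * dx (dt u) p
    - (1 - (dt u p)\<^sup>2) * dx (dx u) p"

lemma string_equation_iff_quasilinear:
  assumes u: "smooth_on half_plane u" "timelike u"
  shows "string_equation u \<longleftrightarrow> (\<forall>p\<in>half_plane. string_operator u p = 0)"
proof -
  let ?S = "area_density u"
  note sm = smooth_on_dt_dx[OF u(1)] smooth_area_density[OF u]
  define W where "W = (\<lambda>q. dt u q / ?S q)"
  define Z where "Z = (\<lambda>q. dx u q / ?S q)"
  have smWZ: "smooth_on half_plane W" "smooth_on half_plane Z"
    unfolding W_def Z_def
    by (intro smooth_on_divide sm; use area_density(1)[OF u(2)] in \<open>force simp: less_le\<close>)+
  have key: "?S p ^ 3 * (dt W p - dx Z p) = string_operator u p" if p: "p \<in> half_plane" for p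
  proof -
    have S: "0 < ?S p" "(?S p)\<^sup>2 = 1 + (dx u p)\<^sup>2 - (dt u p)\<^sup>2"
      using area_density[OF u(2) p] by auto
    have WZ: "W q * ?S q = dt u q" "Z q * ?S q = dx u q" if "q \<in> half_plane" for q
      using area_density(1)[OF u(2) that] by (simp_all add: W_def Z_def)
    \<comment> \<open>The derivatives of the quotients \<open>W\<close> and \<open>Z\<close> are
      recovered from the product rule for \<open>W * S\<close> and \<open>Z * S\<close>.\<close>
    have "dt (\<lambda>q. W q * ?S q) p = dt (dt u) p"
      by (rule partials_cong(1)[OF smooth_on_mult[OF smWZ(1) sm(3)] WZ(1) p])
    moreover have "dx (\<lambda>q. Z q * ?S q) p = dx (dx u) p"
      by (rule partials_cong(2)[OF smooth_on_mult[OF smWZ(2) sm(3)] WZ(2) p])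
    ultimately have Wt: "dt W p * ?S p = dt (dt u) p - W p * dt ?S p"
      and Zx: "dx Z p * ?S p = dx (dx u) p - Z p * dx ?S p"
      by (simp_all add: partials_mult smWZ sm p)
    have "?S p ^ 3 * (dt W p - dx Z p) = (?S p)\<^sup>2 * (dt W p * ?S p - dx Z p * ?S p)"
      by (simp add: power2_eq_square power3_eq_cube algebra_simps)
    also have "\<dots> = (?S p)\<^sup>2 * dt (dt u) p - (W p * ?S p) * (?S p * dt ?S p)
        - (?S p)\<^sup>2 * dx (dx u) p + (Z p * ?S p) * (?S p * dx ?S p)"
      unfolding Wt Zx by (simp add: power2_eq_square algebra_simps)
    also have "\<dots> = string_operator u p"
      unfolding WZ[OF p] partials_area_density[OF u p] S(2) string_operator_def
      by (simp add: power2_eq_square algebra_simps)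
    finally show ?thesis .
  qed
  have "string_equation u \<longleftrightarrow> (\<forall>p\<in>half_plane. dt W p - dx Z p = 0)"
    by (simp add: string_equation_def W_def Z_def area_density_def)
  also have "\<dots> \<longleftrightarrow> (\<forall>p\<in>half_plane. string_operator u p = 0)"
    using key area_density(1)[OF u(2)] by (metis mult_eq_0_iff power_not_zero less_irrefl)
  finally show ?thesis .
qed

text \<open>The numbers \<open>speed_p r q\<close> and \<open>speed_m r q\<close> are the characteristic speeds at a point where
  \<open>\<phi>\<^sub>x = r\<close> and \<open>\<phi>\<^sub>t = q\<close>; they are the two values \<open>l\<close> for which \<open>(1, l, q + l * r)\<close>, a tangent
  vector of the graph of \<open>\<phi>\<close> in Minkowski space, is null.\<close>

definition speed_p :: "real \<Rightarrow> real \<Rightarrow> real" where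
  "speed_p r q = (sqrt (1 + r\<^sup>2 - q\<^sup>2) - r * q) / (1 + r\<^sup>2)"

definition speed_m :: "real \<Rightarrow> real \<Rightarrow> real" where
  "speed_m r q = (- sqrt (1 + r\<^sup>2 - q\<^sup>2) - r * q) / (1 + r\<^sup>2)"

section \<open>Algebra of the null directions\<close>

lemma one_plus_square_pos: "0 < 1 + (r::real)\<^sup>2"
  by (simp add: add_pos_nonneg)

text \<open>Completing the square in the quadratic for \<open>l\<close>. The sign of
  \<open>S\<close> is free, so both speeds are covered.\<close>

lemma null_root:
  fixes r q l S :: real
  assumes "S\<^sup>2 = 1 + r\<^sup>2 - q\<^sup>2" "l = (S - r * q) / (1 + r\<^sup>2)"
  shows "l\<^sup>2 + (q + l * r)\<^sup>2 = 1"
proof -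
  have l: "l * (1 + r\<^sup>2) + r * q = S"
    using assms(2) one_plus_square_pos[of r] by (simp add: field_simps)
  have "(1 + r\<^sup>2) * (l\<^sup>2 + (q + l * r)\<^sup>2 - 1) = (l * (1 + r\<^sup>2) + r * q)\<^sup>2 - (1 + r\<^sup>2 - q\<^sup>2)"
    by (simp add: power2_eq_square algebra_simps)
  also have "\<dots> = 0" using l assms(1) by simp
  finally show ?thesis using one_plus_square_pos[of r] by simp
qed

lemma speeds_null:
  assumes "0 < 1 + r\<^sup>2 - q\<^sup>2"
  shows "(speed_p r q)\<^sup>2 + (q + speed_p r q * r)\<^sup>2 = 1"
    "(speed_m r q)\<^sup>2 + (q + speed_m r q * r)\<^sup>2 = 1"
  using null_root[of "sqrt (1 + r\<^sup>2 - q\<^sup>2)" r q "speed_p r q"]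
    null_root[of "- sqrt (1 + r\<^sup>2 - q\<^sup>2)" r q "speed_m r q"] assms
  by (auto simp: speed_p_def speed_m_def)

lemma speed_diff: "speed_p r q - speed_m r q = 2 * sqrt (1 + r\<^sup>2 - q\<^sup>2) / (1 + r\<^sup>2)"
  by (simp add: speed_p_def speed_m_def diff_divide_distrib[symmetric])

text \<open>Both numbers are roots of
  \<open>(1 + r\<^sup>2) l\<^sup>2 + 2 r q l + q\<^sup>2 - 1 = 0\<close>, which gives their sum and
  product. Being distinct real roots, they force a positive discriminant, and this is how the
  constructed solution is seen to be time-like.\<close>

lemma speed_vieta:
  assumes "x\<^sup>2 + (q + x * r)\<^sup>2 = 1" "y\<^sup>2 + (q + y * r)\<^sup>2 = 1" "x \<noteq> (y::real)"
  shows "(x + y) * (1 + r\<^sup>2) = - 2 * r * q" "x * y * (1 + r\<^sup>2) = q\<^sup>2 - 1" "0 < 1 + r\<^sup>2 - q\<^sup>2"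
proof -
  have "(x - y) * ((x + y) * (1 + r\<^sup>2) + 2 * r * q) = (x\<^sup>2 + (q + x * r)\<^sup>2) - (y\<^sup>2 + (q + y * r)\<^sup>2)"
    by (simp add: power2_eq_square algebra_simps)
  then have "(x - y) * ((x + y) * (1 + r\<^sup>2) + 2 * r * q) = 0"
    using assms by simp
  then show 1: "(x + y) * (1 + r\<^sup>2) = - 2 * r * q"
    using assms(3) by simp
  have "x * y * (1 + r\<^sup>2) = x * ((x + y) * (1 + r\<^sup>2)) - x\<^sup>2 * (1 + r\<^sup>2)"
    by (simp add: power2_eq_square algebra_simps)
  also have "\<dots> = q\<^sup>2 - (x\<^sup>2 + (q + x * r)\<^sup>2)"
    unfolding 1 by (simp add: power2_eq_square algebra_simps)
  finally show 2: "x * y * (1 + r\<^sup>2) = q\<^sup>2 - 1"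
    using assms(1) by simp
  have "((x - y) * (1 + r\<^sup>2))\<^sup>2 = ((x + y) * (1 + r\<^sup>2))\<^sup>2 - 4 * (x * y * (1 + r\<^sup>2)) * (1 + r\<^sup>2)"
    by (simp add: power2_eq_square algebra_simps)
  also have "\<dots> = 4 * (1 + r\<^sup>2 - q\<^sup>2)"
    unfolding 1 2 by (simp add: power2_eq_square algebra_simps)
  finally have "4 * (1 + r\<^sup>2 - q\<^sup>2) = ((x - y) * (1 + r\<^sup>2))\<^sup>2" by simp
  moreover have "0 < ((x - y) * (1 + r\<^sup>2))\<^sup>2"
    using assms(3) one_plus_square_pos[of r] by simp
  ultimately have "0 < 4 * (1 + r\<^sup>2 - q\<^sup>2)" by (simp only:)
  then show "0 < 1 + r\<^sup>2 - q\<^sup>2" by (rule zero_less_mult_pos) simp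
qed

subsection \<open>Existence\<close>

lemma Ck_speeds:
  assumes "Ck k r" "Ck k q" "\<And>x. 0 < 1 + (r x)\<^sup>2 - (q x)\<^sup>2"
  shows "Ck k (\<lambda>x. speed_p (r x) (q x))" "Ck k (\<lambda>x. speed_m (r x) (q x))"
  unfolding speed_p_def speed_m_def power2_eq_square
  using assms one_plus_square_pos
  by (auto intro!: Ck_divide Ck_diff Ck_minus Ck_sqrt Ck_mult Ck_add Ck_const
      simp: power2_eq_square less_le)

text \<open>The position is inverted for the null coordinate \<open>y\<close> at each time;
  \<open>gap\<close> bounds its slope in \<open>y\<close> from below. The second conclusion is the
  formula against which uniqueness is tested.\<close>

lemma characteristic_solution_exists:
  assumes F: "smooth F" and G: "smooth G"
    and timelike0: "\<And>x. 0 < 1 + (deriv F x)\<^sup>2 - (G x)\<^sup>2"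
    and U: "U = (\<lambda>x. speed_p (deriv F x) (G x))" and V: "V = (\<lambda>x. speed_m (deriv F x) (G x))"
    and gap: "0 < c" "\<And>x y. c \<le> U x - V y"
    and s: "\<And>y. (s has_real_derivative U (s y) - V (s y)) (at y)" and surj: "\<And>x. \<exists>y. s y = x"
    and X: "\<And>y. (X has_real_derivative U (s y)) (at y)"
    and P: "\<And>y. (P has_real_derivative G (s y) + U (s y) * deriv F (s y)) (at y)"
  obtains \<phi> where "smooth_string_solution F G \<phi>"
    "\<And>t y. 0 \<le> t \<Longrightarrow> \<phi> (t, X (t + y) - X y + s y) = P (t + y) - P y + F (s y)"
proof -
  have F': "(F has_real_derivative deriv F x) (at x)" for x
    using smooth_imp_has_derivative[OF F] .
  have CkF: "Ck k F" "Ck k (deriv F)" "Ck k G" for k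
    using F G smooth_deriv smooth_imp_Ck by auto
  have CkU: "Ck k U" "Ck k V" for k
    unfolding U V by (intro Ck_speeds CkF timelike0)+
  \<comment> \<open>Bootstrap: \<open>s' = U s - V s\<close> is as regular as \<open>s\<close>, so
    \<open>s\<close> gains one derivative at each stage.\<close>
  have Cks: "Ck k s" for k
  proof (induction k)
    case 0
    then show ?case
      by (metis s DERIV_isCont Ck_0 continuous_at_imp_continuous_on)
  next
    case (Suc k)
    then have "Ck k (\<lambda>y. U (s y) - V (s y))"
      by (intro Ck_diff Ck_compose[OF CkU(1)] Ck_compose[OF CkU(2)])
    with s show ?case by (rule Ck_SucI)
  qed
  define X1 where "X1 y = U (s y)" for y
  define Y1 where "Y1 y = V (s y)" for y
  define P1 where "P1 y = G (s y) + U (s y) * deriv F (s y)" for y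
  define Q1 where "Q1 y = G (s y) + V (s y) * deriv F (s y)" for y
  \<comment> \<open>With these choices position and value at \<open>t = 0\<close> are
    \<open>s y\<close> and \<open>F (s y)\<close>, and \<open>Y'\<close>, \<open>Q'\<close> are the
    analogues of \<open>X'\<close>, \<open>P'\<close> for the speed \<open>V\<close>.\<close>
  define Y where "Y y = X y - s y" for y
  define Q where "Q y = P y - F (s y)" for y
  have DX: "(X has_real_derivative X1 y) (at y)" for y
    using X by (simp add: X1_def)
  have DY: "(Y has_real_derivative Y1 y) (at y)" for y
    unfolding Y_def[abs_def] Y1_def using DERIV_diff[OF X s, of y] by simp
  have DP: "(P has_real_derivative P1 y) (at y)" for y
    using P by (simp add: P1_def)
  have DQ: "(Q has_real_derivative Q1 y) (at y)" for y
    unfolding Q_def[abs_def] Q1_def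
    using DERIV_diff[OF P DERIV_chain2[OF F' s], of y] by (simp add: algebra_simps)
  have Ck1: "Ck k X1" "Ck k Y1" "Ck k P1" "Ck k Q1" for k
    unfolding X1_def[abs_def] Y1_def[abs_def] P1_def[abs_def] Q1_def[abs_def]
    by (intro Ck_add Ck_mult Ck_compose[OF CkU(1)] Ck_compose[OF CkU(2)] Ck_compose[OF CkF(2)]
        Ck_compose[OF CkF(3)] Cks)+
  have CkPQ: "Ck k P" "Ck k Q" for k
    by (rule Ck_SucD[OF Ck_SucI[OF DP Ck1(3)]], rule Ck_SucD[OF Ck_SucI[OF DQ Ck1(4)]])
  obtain X2 where X2: "\<And>y. (X1 has_real_derivative X2 y) (at y)"
    using Ck1(1)[of "Suc 0"] unfolding Ck_Suc by blast
  obtain P2 where P2: "\<And>y. (P1 has_real_derivative P2 y) (at y)"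
    using Ck1(3)[of "Suc 0"] unfolding Ck_Suc by blast
  have gap1: "c \<le> X1 y - Y1 z" for y z
    by (simp add: X1_def Y1_def gap)
  have nullX: "(X1 y)\<^sup>2 + (P1 y)\<^sup>2 = 1" and nullY: "(Y1 y)\<^sup>2 + (Q1 y)\<^sup>2 = 1" for y
    using speeds_null[OF timelike0[of "s y"]] by (auto simp: X1_def Y1_def P1_def Q1_def U V)

  \<comment> \<open>The position as a function of time and \<open>y\<close>; its inverse
    \<open>b\<close> below assigns to \<open>(t, x)\<close> the coordinate \<open>y\<close>.\<close>
  define H where "H p = X (fst p + snd p) - Y (snd p)" for p
  have pfst: "has_partials_on fst (\<lambda>p. 1) (\<lambda>p. 0) S" and psnd: "has_partials_on snd (\<lambda>p. 0) (\<lambda>p. 1) S" for S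
    unfolding has_partials_on_def by (auto intro!: derivative_eq_intros)
  have H: "has_partials_on H (\<lambda>p. X1 (fst p + snd p)) (\<lambda>p. X1 (fst p + snd p) - Y1 (snd p)) half_plane"
    using has_partials_on_add[OF has_partials_on_compose[OF has_partials_on_add[OF pfst psnd] DX]
        has_partials_on_compose[OF psnd DERIV_minus[OF DY]], of half_plane]
    by (simp add: H_def[abs_def])
  obtain b where b: "\<And>t z. 0 \<le> t \<Longrightarrow> H (t, b (t, z)) = z" "\<And>t y. 0 \<le> t \<Longrightarrow> b (t, H (t, y)) = y"
    and pb: "has_partials_on b (\<lambda>p. - X1 (fst p + b p) / (X1 (fst p + b p) - Y1 (b p)))
      (\<lambda>p. 1 / (X1 (fst p + b p) - Y1 (b p))) half_plane"
    using slice_inverse[OF H gap(1)] gap1 by auto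
  have gap_pos: "0 < X1 y - Y1 z" for y z
    using gap1[of y z] gap(1) by linarith
  have Ckb: "Ck_on k half_plane b" for k
  proof (induction k)
    case 0
    then show ?case using has_partials_on_imp_continuous_on[OF pb] by simp
  next
    case (Suc k)
    have 1: "Ck_on k half_plane (\<lambda>p. X1 (fst p + b p))"
      by (intro Ck_on_compose[OF Ck1(1)] Ck_on_add Ck_on_fst Suc)
    have 2: "Ck_on k half_plane (\<lambda>p. Y1 (b p))"
      by (intro Ck_on_compose[OF Ck1(2)] Suc)
    show ?case
      by (rule Ck_on_SucI[OF pb])
        (use gap_pos in \<open>auto intro!: Ck_on_divide Ck_on_minus Ck_on_diff 1 2 simp: less_le\<close>)
  qed
  have sb: "smooth_on half_plane b" "smooth_on half_plane (\<lambda>p. fst p + b p)"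
    using Ckb by (auto simp: smooth_on_def intro: Ck_on_add)
  define \<phi> where "\<phi> p = P (fst p + b p) - Q (b p)" for p
  define x1 where "x1 p = X1 (fst p + b p)" for p
  define y1 where "y1 p = Y1 (b p)" for p
  define p1 where "p1 p = P1 (fst p + b p)" for p
  define q1 where "q1 p = Q1 (b p)" for p
  define d where "d p = 1 / (x1 p - y1 p)" for p
  have smooth: "smooth_on half_plane \<phi>" "smooth_on half_plane x1" "smooth_on half_plane p1"
    unfolding \<phi>_def[abs_def] x1_def[abs_def] p1_def[abs_def]
    using smooth_on_diff[OF smooth_on_compose[OF CkPQ(1) sb(2)] smooth_on_compose[OF CkPQ(2) sb(1)]]
      smooth_on_compose[OF Ck1(1) sb(2)] smooth_on_compose[OF Ck1(3) sb(2)] by auto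
  have d: "(x1 p - y1 p) * d p = 1" for p
    using gap_pos[of "fst p + b p" "b p"] by (simp add: d_def x1_def y1_def)
  have pb': "has_partials_on b (\<lambda>p. - x1 p * d p) d half_plane"
    using pb by (simp add: x1_def y1_def d_def[abs_def])
  note ps = has_partials_on_add[OF pfst pb']
  have partials: "dt \<phi> p = p1 p * (1 - x1 p * d p) + q1 p * (x1 p * d p)"
    "dx \<phi> p = p1 p * d p - q1 p * d p"
    "dt x1 p = X2 (fst p + b p) * (1 - x1 p * d p)" "dx x1 p = X2 (fst p + b p) * d p"
    "dt p1 p = P2 (fst p + b p) * (1 - x1 p * d p)" "dx p1 p = P2 (fst p + b p) * d p"
    if "p \<in> half_plane" for p
  proof -
    have phi: "has_partials_on \<phi> (\<lambda>p. p1 p * (1 - x1 p * d p) + q1 p * (x1 p * d p))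
        (\<lambda>p. p1 p * d p - q1 p * d p) half_plane"
      using has_partials_on_add[OF has_partials_on_compose[OF ps DP]
          has_partials_on_compose[OF pb' DERIV_minus[OF DQ]]]
      by (simp add: \<phi>_def[abs_def] p1_def q1_def)
    have x: "has_partials_on x1 (\<lambda>p. X2 (fst p + b p) * (1 - x1 p * d p)) (\<lambda>p. X2 (fst p + b p) * d p) half_plane"
      using has_partials_on_compose[OF ps X2] by (simp add: x1_def[abs_def])
    have p: "has_partials_on p1 (\<lambda>p. P2 (fst p + b p) * (1 - x1 p * d p)) (\<lambda>p. P2 (fst p + b p) * d p) half_plane"
      using has_partials_on_compose[OF ps P2] by (simp add: p1_def[abs_def])
    show "dt \<phi> p = p1 p * (1 - x1 p * d p) + q1 p * (x1 p * d p)"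
      "dx \<phi> p = p1 p * d p - q1 p * d p"
      "dt x1 p = X2 (fst p + b p) * (1 - x1 p * d p)" "dx x1 p = X2 (fst p + b p) * d p"
      "dt p1 p = P2 (fst p + b p) * (1 - x1 p * d p)" "dx p1 p = P2 (fst p + b p) * d p"
      using dt_eq[OF phi that] dx_eq[OF phi that] dt_eq[OF x that] dx_eq[OF x that]
        dt_eq[OF p that] dx_eq[OF p that] by simp_all
  qed
  \<comment> \<open>The derivatives of \<open>\<phi>\<close> along the two null directions: along
    speed \<open>x1\<close> only \<open>P\<close> varies, along speed \<open>y1\<close> only
    \<open>Q\<close>.\<close>
  have frame: "dt \<phi> p + x1 p * dx \<phi> p = p1 p" "dt \<phi> p + y1 p * dx \<phi> p = q1 p"
    if "p \<in> half_plane" for p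
  proof -
    show "dt \<phi> p + x1 p * dx \<phi> p = p1 p"
      unfolding partials[OF that] by (simp add: algebra_simps)
    have "dt \<phi> p + y1 p * dx \<phi> p = p1 p * (1 - (x1 p - y1 p) * d p) + q1 p * ((x1 p - y1 p) * d p)"
      unfolding partials[OF that] by (simp add: algebra_simps)
    then show "dt \<phi> p + y1 p * dx \<phi> p = q1 p"
      unfolding d by simp
  qed
  have vieta: "(x1 p + y1 p) * (1 + (dx \<phi> p)\<^sup>2) = - 2 * dx \<phi> p * dt \<phi> p"
    "x1 p * y1 p * (1 + (dx \<phi> p)\<^sup>2) = (dt \<phi> p)\<^sup>2 - 1"
    "0 < 1 + (dx \<phi> p)\<^sup>2 - (dt \<phi> p)\<^sup>2" if "p \<in> half_plane" for p
  proof -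
    have "(x1 p)\<^sup>2 + (dt \<phi> p + x1 p * dx \<phi> p)\<^sup>2 = 1" "(y1 p)\<^sup>2 + (dt \<phi> p + y1 p * dx \<phi> p)\<^sup>2 = 1"
      unfolding frame[OF that] by (simp_all add: x1_def y1_def p1_def q1_def nullX nullY)
    moreover have "x1 p \<noteq> y1 p"
      using gap_pos[of "fst p + b p" "b p"] by (simp add: x1_def y1_def)
    ultimately show "(x1 p + y1 p) * (1 + (dx \<phi> p)\<^sup>2) = - 2 * dx \<phi> p * dt \<phi> p"
      "x1 p * y1 p * (1 + (dx \<phi> p)\<^sup>2) = (dt \<phi> p)\<^sup>2 - 1" "0 < 1 + (dx \<phi> p)\<^sup>2 - (dt \<phi> p)\<^sup>2"
      by (rule speed_vieta)+
  qed
  then have tl: "timelike \<phi>"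
    by (simp add: timelike_def)
  have op: "string_operator \<phi> p = 0" if p: "p \<in> half_plane" for p
  proof -
    note sm = smooth_on_dt_dx[OF smooth(1)]
    define r where "r = dx \<phi> p"
    \<comment> \<open>Differentiation along speed \<open>y1\<close>, which leaves
      \<open>t + y\<close> fixed and so annihilates \<open>x1\<close> and \<open>p1\<close>,
      functions of \<open>t + y\<close> alone.\<close>
    define L where "L u = dt u p + y1 p * dx u p" for u
    have transport: "L x1 = 0" "L p1 = 0"
    proof -
      have "L x1 = X2 (fst p + b p) * (1 - (x1 p - y1 p) * d p)"
        "L p1 = P2 (fst p + b p) * (1 - (x1 p - y1 p) * d p)"
        unfolding L_def partials[OF p] by (simp_all add: algebra_simps)
      then show "L x1 = 0" "L p1 = 0" unfolding d by simp_all
    qed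
    \<comment> \<open>Applying \<open>L\<close> to
      \<open>\<phi>\<^sub>t + x1 * \<phi>\<^sub>x = p1\<close> yields a second order equation with
      coefficients \<open>x1 + y1\<close> and \<open>x1 * y1\<close>; \<open>vieta\<close> turns it
      into the string equation.\<close>
    let ?k = "\<lambda>p. dt \<phi> p + x1 p * dx \<phi> p"
    have "L ?k = L p1"
      unfolding L_def
      using partials_cong[of ?k p1 p] frame(1) p smooth_on_add[OF sm(1) smooth_on_mult[OF smooth(2) sm(2)]]
      by simp
    moreover have "L ?k = L (dt \<phi>) + x1 p * L (dx \<phi>) + L x1 * r"
      by (simp add: L_def r_def partials_add partials_mult p sm smooth smooth_on_mult algebra_simps)
    ultimately have "L (dt \<phi>) + x1 p * L (dx \<phi>) = 0"
      using transport by simp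
    then have "dt (dt \<phi>) p + (x1 p + y1 p) * dx (dt \<phi>) p + x1 p * y1 p * dx (dx \<phi>) p = 0"
      using dt_dx_commute[OF smooth(1) p] by (simp add: L_def algebra_simps)
    moreover have "(1 + r\<^sup>2) * dt (dt \<phi>) p + ((x1 p + y1 p) * (1 + r\<^sup>2)) * dx (dt \<phi>) p
        + (x1 p * y1 p * (1 + r\<^sup>2)) * dx (dx \<phi>) p
      = (1 + r\<^sup>2) * (dt (dt \<phi>) p + (x1 p + y1 p) * dx (dt \<phi>) p + x1 p * y1 p * dx (dx \<phi>) p)"
      by (simp add: algebra_simps)
    ultimately have "(1 + r\<^sup>2) * dt (dt \<phi>) p + ((x1 p + y1 p) * (1 + r\<^sup>2)) * dx (dt \<phi>) p
        + (x1 p * y1 p * (1 + r\<^sup>2)) * dx (dx \<phi>) p = 0"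
      by simp
    then show ?thesis
      unfolding r_def vieta[OF p] string_operator_def by (simp add: algebra_simps)
  qed
  have b0: "s (b (0, x)) = x" for x
    using b(1)[of 0 x] by (simp add: H_def Y_def)
  have "\<phi> (0, x) = F x" for x
    using b0 by (simp add: \<phi>_def Q_def)
  moreover have "dt \<phi> (0, x) = G x" for x
  proof -
    have "deriv F x = dx \<phi> (0, x)"
      using calculation by (simp add: dx_def fun_eq_iff)
    then show ?thesis
      using frame(1)[of "(0, x)"] b0 by (simp add: x1_def p1_def X1_def P1_def)
  qed
  ultimately have sol: "smooth_string_solution F G \<phi>"
    using smooth(1) tl op string_equation_iff_quasilinear[OF smooth(1) tl]
    by (simp add: smooth_string_solution_def)
  have "\<phi> (t, X (t + y) - X y + s y) = P (t + y) - P y + F (s y)" if "0 \<le> t" for t y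
    using b(2)[OF that, of y] by (simp add: H_def Y_def \<phi>_def Q_def algebra_simps)
  with sol show thesis by (rule that)
qed

subsection \<open>Uniqueness\<close>

text \<open>Through \<open>(t, x)\<close> runs a characteristic of speed \<open>l\<close>. Each of
  its points is joined to the initial line by a curve of speed \<open>n\<close> that carries the
  initial values of \<open>l\<close> and \<open>q + l * r\<close>, so position and value along it
  are integrals of the data.\<close>

lemma solution_along_characteristics:
  assumes sol: "smooth_string_solution F G \<psi>"
    and U: "U = (\<lambda>x. speed_p (deriv F x) (G x))" and V: "V = (\<lambda>x. speed_m (deriv F x) (G x))"
    and a: "\<And>x. (a has_real_derivative 1 / (U x - V x)) (at x)"
    and as: "\<And>y. a (s y) = y" and sa: "\<And>x. s (a x) = x"
    and X: "\<And>y. (X has_real_derivative U (s y)) (at y)"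
    and P: "\<And>y. (P has_real_derivative G (s y) + U (s y) * deriv F (s y)) (at y)"
    and t: "0 \<le> t"
  obtains y where "x = X (t + y) - X y + s y" "\<psi> (t, x) = P (t + y) - P y + F (s y)"
proof -
  have sm: "smooth_on half_plane \<psi>" and tl: "timelike \<psi>"
    and init: "\<And>x. \<psi> (0, x) = F x" "\<And>x. dt \<psi> (0, x) = G x"
    and eq: "\<And>p. p \<in> half_plane \<Longrightarrow> string_operator \<psi> p = 0"
    using sol string_equation_iff_quasilinear[of \<psi>] unfolding smooth_string_solution_def by auto
  have init_x: "dx \<psi> (0, x) = deriv F x" for x
    by (simp add: dx_def init)
  define q where "q = dt \<psi>"
  define r where "r = dx \<psi>"
  define S where "S = area_density \<psi>"
  have smq: "smooth_on half_plane q" "smooth_on half_plane r" "smooth_on half_plane S"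
    using smooth_on_dt_dx[OF sm] smooth_area_density[OF sm tl] by (auto simp: q_def r_def S_def)
  have Spos: "0 < S p" and Ssq: "(S p)\<^sup>2 = 1 + (r p)\<^sup>2 - (q p)\<^sup>2" if "p \<in> half_plane" for p
    using area_density[OF tl that] by (auto simp: S_def q_def r_def)
  have Sne: "S p \<noteq> 0" if "p \<in> half_plane" for p
    using Spos[OF that] by simp
  have rpos: "1 + (r p)\<^sup>2 \<noteq> 0" for p
    using one_plus_square_pos[of "r p"] by simp
  \<comment> \<open>The conservation law is halved and its flux shifted by \<open>1 / 2\<close>,
    which makes \<open>e = 1 / (l - n)\<close>, \<open>m = - l * e\<close> and
    \<open>m + 1 = - n * e\<close>.\<close>
  define m where "m p = (r p * q p / S p - 1) / 2" for p
  define e where "e p = ((1 + (r p)\<^sup>2) / S p) / 2" for p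
  define l where "l p = (S p - r p * q p) / (1 + (r p)\<^sup>2)" for p
  define n where "n p = (- S p - r p * q p) / (1 + (r p)\<^sup>2)" for p
  define k where "k p = q p + l p * r p" for p
  have sme: "smooth_on half_plane m" "smooth_on half_plane e" "smooth_on half_plane l"
    unfolding m_def[abs_def] e_def[abs_def] l_def[abs_def]
    by (intro smooth_on_intros smq; use Sne rpos in simp)+
  have smk: "smooth_on half_plane k"
    unfolding k_def[abs_def] by (intro smooth_on_intros smq sme)
  have commute: "dt r p = dx q p" if "p \<in> half_plane" for p
    using dt_dx_commute[OF sm that] by (simp add: q_def r_def)
  have quasi: "(1 + (r p)\<^sup>2) * dt q p - 2 * r p * q p * dx q p - (1 - (q p)\<^sup>2) * dx r p = 0"
    if "p \<in> half_plane" for p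
    using eq[OF that] by (simp add: string_operator_def q_def r_def)

  \<comment> \<open>Up to the factor \<open>2 * S\<^sup>3\<close>, the difference of the two sides
    is \<open>q\<close> times the nondivergence form of the equation.\<close>
  have conservation: "dt e p = dx m p" if p: "p \<in> half_plane" for p
  proof -
    have S': "S p * dt S p = r p * dx q p - q p * dt q p" "S p * dx S p = r p * dx r p - q p * dx q p"
      using partials_area_density[OF sm tl p] by (simp_all add: S_def q_def r_def)
    have "2 * (e p * S p) = 1 + r p * r p" if "p \<in> half_plane" for p
      using Sne[OF that] by (simp add: e_def power2_eq_square)
    then have "dt (\<lambda>p. 2 * (e p * S p)) p = dt (\<lambda>p. 1 + r p * r p) p"
      by (intro partials_cong(1)[OF _ _ p] smooth_on_intros sme smq)
    then have e': "dt e p * S p + e p * dt S p = r p * dx q p"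
      by (simp add: partials_add partials_mult partials_const smooth_on_intros sme smq p commute)
    have "(2 * m p + 1) * S p = r p * q p" if "p \<in> half_plane" for p
      using Sne[OF that] by (simp add: m_def field_simps)
    then have "dx (\<lambda>p. (2 * m p + 1) * S p) p = dx (\<lambda>p. r p * q p) p"
      by (intro partials_cong(2)[OF _ _ p] smooth_on_intros sme smq)
    then have m': "2 * dx m p * S p + (2 * m p + 1) * dx S p = dx r p * q p + r p * dx q p"
      by (simp add: partials_add partials_mult partials_const smooth_on_intros sme smq p)
    have em: "2 * e p * S p = 1 + (r p)\<^sup>2" "(2 * m p + 1) * S p = r p * q p"
      using Sne[OF p] by (simp_all add: e_def m_def field_simps)
    have "2 * (S p)^3 * (dt e p - dx m p)
        = (S p)\<^sup>2 * (2 * (dt e p * S p + e p * dt S p) - (2 * dx m p * S p + (2 * m p + 1) * dx S p))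
          - (2 * e p * S p) * (S p * dt S p) + ((2 * m p + 1) * S p) * (S p * dx S p)"
      by (simp add: power2_eq_square power3_eq_cube algebra_simps)
    also have "\<dots> = q p * ((1 + (r p)\<^sup>2) * dt q p - 2 * r p * q p * dx q p - (1 - (q p)\<^sup>2) * dx r p)"
      unfolding e' m' em S' Ssq[OF p] by (simp add: power2_eq_square algebra_simps)
    also have "\<dots> = 0" using quasi[OF p] by simp
    finally show ?thesis using Sne[OF p] by simp
  qed

  \<comment> \<open>With \<open>L\<close> the derivative along speed \<open>n\<close>: the equation
    gives \<open>L k = r * L l\<close>, and \<open>l\<^sup>2 + k\<^sup>2 = 1\<close> gives
    \<open>l * L l + k * L k = 0\<close>. Hence \<open>(l + k * r) * L l = 0\<close>, where
    \<open>l + k * r = S\<close> is nonzero.\<close>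
  have transport: "dt l p + n p * dx l p = 0" "dt k p + n p * dx k p = 0" if p: "p \<in> half_plane" for p
  proof -
    define L where "L u = dt u p + n p * dx u p" for u
    have lk: "l p * l p + k p * k p = 1" if "p \<in> half_plane" for p
      using null_root[OF Ssq[OF that] l_def] by (simp add: k_def power2_eq_square)
    have n: "(n p)\<^sup>2 + (q p + n p * r p)\<^sup>2 = 1"
      by (rule null_root[of "- S p"]) (use Ssq[OF p] in \<open>simp_all add: n_def\<close>)
    have l: "(l p)\<^sup>2 + (q p + l p * r p)\<^sup>2 = 1"
      by (rule null_root[OF Ssq[OF p] l_def])
    have "l p \<noteq> n p"
      using Spos[OF p] rpos[of p] by (simp add: l_def n_def)
    note vieta = speed_vieta(1,2)[OF l n this]
    have "L (\<lambda>p. l p * l p + k p * k p) = L (\<lambda>p. 1)"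
      unfolding L_def
      using partials_cong[of "\<lambda>p. l p * l p + k p * k p" "\<lambda>p. 1" p] lk p
      by (simp add: smooth_on_intros sme smk)
    then have 1: "l p * L l + k p * L k = 0"
      by (simp add: L_def partials_add partials_mult partials_const p sme smk smooth_on_intros algebra_simps)
    have "L k = L q + L l * r p + l p * L r"
      unfolding k_def[abs_def]
      by (simp add: L_def partials_add partials_mult p sme smq smooth_on_intros algebra_simps)
    moreover have "(1 + (r p)\<^sup>2) * (L q + l p * L r) = (1 + (r p)\<^sup>2) * dt q p
        + ((l p + n p) * (1 + (r p)\<^sup>2)) * dx q p + (l p * n p * (1 + (r p)\<^sup>2)) * dx r p"
      by (simp add: L_def commute[OF p] algebra_simps)
    then have "(1 + (r p)\<^sup>2) * (L q + l p * L r) = 0"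
      unfolding vieta using quasi[OF p] by (simp add: algebra_simps)
    ultimately have 2: "L k = r p * L l"
      using rpos[of p] by simp
    have "l p * (1 + (r p)\<^sup>2) = S p - r p * q p"
      using rpos[of p] by (simp add: l_def)
    then have "l p + k p * r p = S p"
      by (simp add: k_def power2_eq_square algebra_simps)
    moreover have "(l p + k p * r p) * L l = 0"
      using 1 unfolding 2 by (simp add: algebra_simps)
    ultimately have "L l = 0" using Sne[OF p] by simp
    with 2 show "dt l p + n p * dx l p = 0" "dt k p + n p * dx k p = 0"
      by (simp_all add: L_def)
  qed

  have e0: "e (0, x) = 1 / (U x - V x)" for x
    by (simp add: e_def U V speed_diff S_def area_density_def r_def init init_x)
  have l0: "l (0, x) = U x" "k (0, x) = G x + U x * deriv F x" for x
    by (simp_all add: k_def l_def U speed_p_def S_def area_density_def q_def r_def init init_x)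
  \<comment> \<open>From \<open>S\<^sup>2 \<le> 1 + r\<^sup>2 \<le> (1 + r\<^sup>2)\<^sup>2\<close>.
    The bound is uniform whatever the size of the gradient, so the level sets of the potential below
    are global.\<close>
  have e_bound: "1 / 2 \<le> e p" if p: "p \<in> half_plane" for p
  proof -
    have "(S p)\<^sup>2 \<le> (1 + (r p)\<^sup>2) * 1"
      unfolding Ssq[OF p] by simp
    also have "\<dots> \<le> (1 + (r p)\<^sup>2) * (1 + (r p)\<^sup>2)"
      by (intro mult_left_mono) auto
    finally have "(S p)\<^sup>2 \<le> (1 + (r p)\<^sup>2)\<^sup>2"
      unfolding power2_eq_square[of "1 + (r p)\<^sup>2"] .
    then have "S p \<le> 1 + (r p)\<^sup>2"
      by (rule power2_le_imp_le) simp
    then show ?thesis using Spos[OF p] by (simp add: e_def field_simps)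
  qed

  \<comment> \<open>The potential with \<open>B\<^sub>t = m\<close>, \<open>B\<^sub>x = e\<close>
    and \<open>B (0, x) = a x\<close>. Level sets of \<open>B\<close> have speed \<open>l\<close>,
    those of \<open>B + t\<close> have speed \<open>n\<close>.\<close>
  define B where "B p = a (snd p) + integral {0..fst p} (\<lambda>s. m (s, snd p))" for p
  have pm: "has_partials_on m (dt m) (dx m) half_plane"
    by (rule smooth_on_has_partials[OF sme(1)])
  have "has_partials_on e (dx m) (dx e) half_plane"
    using smooth_on_has_partials[OF sme(2)] has_partials_on_cong[of half_plane e e "dt e" "dx m" "dx e" "dx e"]
      conservation by simp
  from has_partials_on_potential[OF pm this smooth_on_imp_continuous_on[OF smooth_on_dt_dx(2)[OF sme(1)]], of a]
  have pB: "has_partials_on B m e half_plane"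
    using a e0 by (simp add: B_def[abs_def])
  have "has_partials_on fst (\<lambda>p. 1) (\<lambda>p. 0) half_plane"
    unfolding has_partials_on_def by (auto intro!: derivative_eq_intros)
  from has_partials_on_add[OF pB this]
  have pA: "has_partials_on (\<lambda>p. B p + fst p) (\<lambda>p. m p + 1) e half_plane"
    by simp
  obtain \<Xi> where \<Xi>: "\<And>t z. 0 \<le> t \<Longrightarrow> B (t, \<Xi> (t, z)) = z" "\<And>t y. 0 \<le> t \<Longrightarrow> \<Xi> (t, B (t, y)) = y"
    "has_partials_on \<Xi> (\<lambda>p. - m (fst p, \<Xi> p) / e (fst p, \<Xi> p)) (\<lambda>p. 1 / e (fst p, \<Xi> p)) half_plane"
    by (rule slice_inverse[OF pB _ e_bound]) auto
  obtain N where N: "\<And>t z. 0 \<le> t \<Longrightarrow> B (t, N (t, z)) + t = z" "\<And>t y. 0 \<le> t \<Longrightarrow> N (t, B (t, y) + t) = y"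
    "has_partials_on N (\<lambda>p. - (m (fst p, N p) + 1) / e (fst p, N p)) (\<lambda>p. 1 / e (fst p, N p)) half_plane"
    by (rule slice_inverse[OF pA _ e_bound]) auto
  have speeds: "- m p / e p = l p" "- (m p + 1) / e p = n p" if "p \<in> half_plane" for p
  proof -
    have "l p * e p = (S p - r p * q p) / S p / 2" "n p * e p = (- S p - r p * q p) / S p / 2"
      using rpos[of p] by (simp_all add: l_def n_def e_def)
    then have "l p * e p = - m p" "n p * e p = - (m p + 1)"
      using Sne[OF that] by (simp_all add: m_def diff_divide_distrib)
    moreover have "e p \<noteq> 0"
      using e_bound[OF that] by auto
    ultimately show "- m p / e p = l p" "- (m p + 1) / e p = n p"
      by (metis nonzero_mult_div_cancel_right)+
  qed

  \<comment> \<open>The curve \<open>N (\<cdot>, z)\<close> has speed \<open>n\<close> and starts at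
    \<open>s z\<close>, because \<open>B + t\<close> equals \<open>a\<close> at
    \<open>t = 0\<close>.\<close>
  have invariants: "l (t, N (t, z)) = U (s z)" "k (t, N (t, z)) = G (s z) + U (s z) * deriv F (s z)"
    if "0 \<le> t" for t z
  proof -
    have DN: "((\<lambda>t. N (t, z)) has_real_derivative n (t, N (t, z))) (at t within {0..})" if "0 \<le> t" for t
      using has_partials_on_time[OF N(3) that, of z] speeds(2)[of "(t, N (t, z))"] that by simp
    have N0: "N (0, z) = s z"
      using N(2)[of 0 "s z"] by (simp add: B_def as)
    have "l (t, N (t, z)) = l (0, N (0, z))"
      by (rule DERIV_atLeast_zero_constant[OF _ that])
        (use has_partials_on_curve[OF smooth_on_has_partials[OF sme(3)] _ DN] transport(1) in
          \<open>force simp: mult.commute\<close>)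
    then show "l (t, N (t, z)) = U (s z)" by (simp add: N0 l0)
    have "k (t, N (t, z)) = k (0, N (0, z))"
      by (rule DERIV_atLeast_zero_constant[OF _ that])
        (use has_partials_on_curve[OF smooth_on_has_partials[OF smk] _ DN] transport(2) in
          \<open>force simp: mult.commute\<close>)
    then show "k (t, N (t, z)) = G (s z) + U (s z) * deriv F (s z)" by (simp add: N0 l0)
  qed

  define y where "y = B (t, x)"
  \<comment> \<open>At time \<open>\<tau>\<close> the level set \<open>B = y\<close> meets the level
    set \<open>B + t = \<tau> + y\<close>, which fixes \<open>l\<close> and \<open>k\<close>
    there.\<close>
  have \<Xi>N: "\<Xi> (\<tau>, y) = N (\<tau>, \<tau> + y)" if "0 \<le> \<tau>" for \<tau>
    using N(2)[OF that, of "\<Xi> (\<tau>, y)"] \<Xi>(1)[OF that, of y] by (simp add: add.commute)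
  have D\<Xi>: "((\<lambda>\<tau>. \<Xi> (\<tau>, y)) has_real_derivative U (s (\<tau> + y))) (at \<tau> within {0..})" if "0 \<le> \<tau>" for \<tau>
    using has_partials_on_time[OF \<Xi>(3) that, of y] speeds(1)[of "(\<tau>, \<Xi> (\<tau>, y))"] that
      invariants(1)[OF that, of "\<tau> + y"] \<Xi>N[OF that] by simp
  have shift: "((\<lambda>\<tau>. \<tau> + y) has_real_derivative 1) (at \<tau> within {0..})" for \<tau>
    by (auto intro!: derivative_eq_intros)
  have DX: "((\<lambda>\<tau>. X (\<tau> + y)) has_real_derivative U (s (\<tau> + y))) (at \<tau> within {0..})" for \<tau>
    using DERIV_chain2[OF X shift] by simp
  have D\<psi>: "((\<lambda>\<tau>. \<psi> (\<tau>, \<Xi> (\<tau>, y))) has_real_derivative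
      G (s (\<tau> + y)) + U (s (\<tau> + y)) * deriv F (s (\<tau> + y))) (at \<tau> within {0..})" if "0 \<le> \<tau>" for \<tau>
    using has_partials_on_curve[OF smooth_on_has_partials[OF sm] that D\<Xi>[OF that]]
      invariants[OF that, of "\<tau> + y"] \<Xi>N[OF that]
    by (simp add: k_def q_def r_def mult.commute)
  have DP: "((\<lambda>\<tau>. P (\<tau> + y)) has_real_derivative
      G (s (\<tau> + y)) + U (s (\<tau> + y)) * deriv F (s (\<tau> + y))) (at \<tau> within {0..})" for \<tau>
    using DERIV_chain2[OF P shift] by simp
  have ends: "\<Xi> (t, y) = x" "\<Xi> (0, y) = s y"
    using \<Xi>(2)[OF t, of x] \<Xi>(2)[of 0 "s y"] by (simp_all add: y_def B_def as)
  show thesis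
  proof (rule that[of y])
    show "x = X (t + y) - X y + s y"
      using DERIV_atLeast_eq[OF D\<Xi> DX t] ends by simp
    show "\<psi> (t, x) = P (t + y) - P y + F (s y)"
      using DERIV_atLeast_eq[OF D\<psi> DP t] ends init by simp
  qed
qed

text \<open>The gap compares the two speeds at arbitrary, possibly different points, since
  characteristics from far apart meet at later times.\<close>

proposition string_cauchy_problem:
  assumes F: "smooth F" and G: "smooth G"
    and timelike0: "\<And>x. 0 < 1 + (deriv F x)\<^sup>2 - (G x)\<^sup>2"
    and gap: "0 < c" "\<And>x y. c \<le> speed_p (deriv F x) (G x) - speed_m (deriv F y) (G y)"
  shows "\<exists>\<phi>. smooth_string_solution F G \<phi> \<and>
    (\<forall>\<psi>. smooth_string_solution F G \<psi> \<longrightarrow> (\<forall>p\<in>half_plane. \<psi> p = \<phi> p))"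
proof -
  define U where "U = (\<lambda>x. speed_p (deriv F x) (G x))"
  define V where "V = (\<lambda>x. speed_m (deriv F x) (G x))"
  have cF: "continuous_on UNIV (deriv F)" "continuous_on UNIV G"
    using smooth_imp_Ck[of _ 0] F G smooth_deriv unfolding Ck_0 by auto
  have cUV: "continuous_on UNIV U" "continuous_on UNIV V"
    using Ck_speeds[of 0 "deriv F" G] timelike0 cF unfolding U_def V_def Ck_0 by auto
  \<comment> \<open>By the null identity both speeds lie in \<open>[-1, 1]\<close>.\<close>
  have W2: "U x - V x \<le> 2" for x
  proof -
    have "(U x)\<^sup>2 \<le> 1" "(V x)\<^sup>2 \<le> 1"
      using speeds_null[OF timelike0[of x]] unfolding U_def V_def by (smt (verit) zero_le_power2)+
    then show ?thesis by (simp add: abs_square_le_1)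
  qed
  have W0: "0 < U x - V x" for x
    using gap(1) gap(2)[of x x] by (simp add: U_def V_def)
  obtain a s where as: "\<And>x. (a has_real_derivative 1 / (U x - V x)) (at x)"
    "\<And>y. (s has_real_derivative U (s y) - V (s y)) (at y)" "\<And>y. a (s y) = y" "\<And>x. s (a x) = x"
    by (rule inverse_flow[OF continuous_on_diff[OF cUV] W0 W2]) (rule that)
  have cs: "continuous_on UNIV s"
    by (metis as(2) DERIV_isCont continuous_at_imp_continuous_on)
  have comp: "continuous_on UNIV (\<lambda>y. f (s y))" if "continuous_on UNIV f" for f :: "real \<Rightarrow> real"
    by (rule continuous_on_compose2[OF that cs]) simp
  obtain X where X: "\<And>y. (X has_real_derivative U (s y)) (at y)"
    by (rule antiderivative[OF comp[OF cUV(1)]]) (rule that)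
  have cGF: "continuous_on UNIV (\<lambda>x. G x + U x * deriv F x)"
    by (intro continuous_intros cF cUV)
  obtain P where P: "\<And>y. (P has_real_derivative G (s y) + U (s y) * deriv F (s y)) (at y)"
    by (rule antiderivative[OF comp[OF cGF]]) (rule that)
  have surj: "\<exists>y. s y = x" for x
    by (rule exI[of _ "a x"]) (rule as(4))
  have gapUV: "c \<le> U x - V y" for x y
    using gap(2) by (simp add: U_def V_def)
  obtain \<phi> where \<phi>: "smooth_string_solution F G \<phi>"
    "\<And>t y. 0 \<le> t \<Longrightarrow> \<phi> (t, X (t + y) - X y + s y) = P (t + y) - P y + F (s y)"
    by (rule characteristic_solution_exists[OF F G timelike0 U_def V_def gap(1) gapUV as(2) surj X P]) (rule that)
  \<comment> \<open>The label \<open>y\<close> found for \<open>\<psi>\<close> depends on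
    \<open>\<psi>\<close>, but the formula for \<open>\<phi>\<close> holds for every
    \<open>y\<close>.\<close>
  have "\<psi> p = \<phi> p" if "smooth_string_solution F G \<psi>" "p \<in> half_plane" for \<psi> p
  proof -
    obtain t x where p: "p = (t, x)" "0 \<le> t"
      using \<open>p \<in> half_plane\<close> by (cases p) auto
    show ?thesis
      unfolding p(1)
      by (rule solution_along_characteristics[OF that(1) U_def V_def as(1,3,4) X P p(2), of x])
        (use \<phi>(2)[OF p(2)] in simp)
  qed
  with \<phi>(1) show ?thesis by blast
qed

subsection \<open>Bounds on the initial speeds\<close>

text \<open>The fundamental theorem of calculus for \<open>(1 + x - y) * (f\<^sup>2 + g\<^sup>2)\<close> on \<open>x \<le> y \<le> x + 1\<close>.\<close>

lemma weighted_bound_imp_bounded: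
  assumes \<gamma>: "0 < \<gamma>" and f: "smooth f" and g: "smooth g" and wb: "weighted_bound \<gamma> I f g"
  shows "(f x)\<^sup>2 + (g x)\<^sup>2 \<le> 3 * I"
proof -
  define w where "w k y = (1 + \<bar>y\<bar>) powr (2 + 2 * \<gamma>) *
    (\<bar>(deriv ^^ k) f y\<bar>\<^sup>2 + \<bar>(deriv ^^ k) g y\<bar>\<^sup>2)" for k y
  have w: "integrable lborel (w k)" "(LINT y|lborel. w k y) \<le> I" for k
    using wb by (auto simp: weighted_bound_def w_def[abs_def] Let_def)
  \<comment> \<open>\<open>D\<close> below is dominated by two copies of
    \<open>f\<^sup>2 + g\<^sup>2\<close> and one of the squared derivatives, whence the factor
    \<open>3\<close>.\<close>
  define u where "u y = 2 * w 0 y + w 1 y" for y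
  have u: "integrable lborel u" "(LINT y|lborel. u y) \<le> 3 * I"
    using w[of 0] w[of 1] by (auto simp: u_def[abs_def])
  have wge: "((deriv ^^ k) f y)\<^sup>2 + ((deriv ^^ k) g y)\<^sup>2 \<le> w k y" for k y
  proof -
    have "1 \<le> (1 + \<bar>y\<bar>) powr (2 + 2 * \<gamma>)"
      using \<gamma> by (intro ge_one_powr_ge_zero) auto
    then show ?thesis
      unfolding w_def power2_abs using mult_right_mono[of 1 _ "((deriv ^^ k) f y)\<^sup>2 + ((deriv ^^ k) g y)\<^sup>2"]
      by simp
  qed
  have u0: "0 \<le> u y" for y
    using wge[of 0 y] wge[of 1 y] unfolding u_def by (smt (verit) zero_le_power2)
  \<comment> \<open>The derivative of \<open>- (1 + x - y) * (f\<^sup>2 + g\<^sup>2)\<close>, a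
    primitive that vanishes at \<open>y = x + 1\<close>, so only the value at \<open>x\<close>
    remains.\<close>
  define D where "D y = (f y)\<^sup>2 + (g y)\<^sup>2
    - 2 * (1 + x - y) * (f y * deriv f y + g y * deriv g y)" for y
  have "((\<lambda>y. - ((1 + x - y) * ((f y)\<^sup>2 + (g y)\<^sup>2))) has_real_derivative D y) (at y within A)" for y A
    unfolding D_def
    by (auto intro!: derivative_eq_intros has_field_derivative_at_within[OF smooth_imp_has_derivative[OF f]]
        has_field_derivative_at_within[OF smooth_imp_has_derivative[OF g]] simp: algebra_simps)
  then have "(D has_integral (f x)\<^sup>2 + (g x)\<^sup>2) {x..x + 1}"
    using fundamental_theorem_of_calculus[of x "x + 1" "\<lambda>y. - ((1 + x - y) * ((f y)\<^sup>2 + (g y)\<^sup>2))" D]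
    by (simp add: has_real_derivative_iff_has_vector_derivative add.commute)
  moreover have uI: "u integrable_on {x..x + 1}"
    using integrable_on_subinterval[OF integrable_on_lborel[OF u(1)]] by simp
  moreover have "D y \<le> u y" if "y \<in> {x..x + 1}" for y
  proof -
    define \<theta> where "\<theta> = 1 + x - y"
    have \<theta>: "0 \<le> \<theta>" "\<theta> \<le> 1" using that by (auto simp: \<theta>_def)
    have sq: "- 2 * \<theta> * (p * q) \<le> p\<^sup>2 + q\<^sup>2" for p q :: real
    proof -
      have "- 2 * \<theta> * (p * q) \<le> \<theta> * (p\<^sup>2 + q\<^sup>2)"
        using mult_left_mono[OF sum_squares_ge_zero[of "p + q" 0] \<theta>(1)]
        by (simp add: power2_eq_square algebra_simps)
      also have "\<dots> \<le> 1 * (p\<^sup>2 + q\<^sup>2)"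
        using \<theta> by (intro mult_right_mono) auto
      finally show ?thesis by simp
    qed
    have "D y = (f y)\<^sup>2 + (g y)\<^sup>2 + (- 2 * \<theta> * (f y * deriv f y)) + (- 2 * \<theta> * (g y * deriv g y))"
      by (simp add: D_def \<theta>_def algebra_simps)
    also have "\<dots> \<le> (f y)\<^sup>2 + (g y)\<^sup>2 + ((f y)\<^sup>2 + (deriv f y)\<^sup>2) + ((g y)\<^sup>2 + (deriv g y)\<^sup>2)"
      by (intro add_mono sq order_refl)
    also have "\<dots> = 2 * ((f y)\<^sup>2 + (g y)\<^sup>2) + ((deriv f y)\<^sup>2 + (deriv g y)\<^sup>2)"
      by simp
    also have "\<dots> \<le> u y"
      using wge[of 0 y] wge[of 1 y] by (simp add: u_def)
    finally show ?thesis .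
  qed
  ultimately have "(f x)\<^sup>2 + (g x)\<^sup>2 \<le> integral {x..x + 1} u"
    using has_integral_le integrable_integral by blast
  also have "\<dots> \<le> integral UNIV u"
    using uI u0 integrable_on_lborel[OF u(1)] by (intro integral_subset_le) auto
  also have "\<dots> \<le> 3 * I"
    using u integral_lborel[OF u(1)] by simp
  finally show ?thesis .
qed

text \<open>As a sum of squares, the distance of a speed from \<open>1\<close> can be read off: it
  is small if \<open>q + r\<close> is small and \<open>S\<close> is near \<open>1\<close>, and
  bounded below when the root \<open>S\<close> is negative.\<close>

lemma one_minus_null_root:
  fixes r q l S :: real
  assumes "S\<^sup>2 = 1 + r\<^sup>2 - q\<^sup>2" "l = (S - r * q) / (1 + r\<^sup>2)"
  shows "1 - l = ((q + r)\<^sup>2 + (1 - S)\<^sup>2) / (2 * (1 + r\<^sup>2))"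
proof -
  have "1 - l = (2 * (1 + r\<^sup>2 + r * q - S)) / (2 * (1 + r\<^sup>2))"
    unfolding assms(2) using one_plus_square_pos[of r] by (simp add: field_simps)
  also have "2 * (1 + r\<^sup>2 + r * q - S) = (q + r)\<^sup>2 + (1 - S)\<^sup>2"
    using assms(1) by (simp add: power2_eq_square algebra_simps)
  finally show ?thesis .
qed

text \<open>Only \<open>q + r = \<delta> * f\<close> is small, and
  \<open>S\<^sup>2 = 1 - \<delta> * f * g\<close> is near \<open>1\<close>. With
  \<open>T = 1 + K\<close>, the plus speed is within \<open>1 / (8 * T)\<close> of \<open>1\<close>,
  while the minus speed stays \<open>1 / (2 * T)\<close> below \<open>1\<close>, since
  \<open>1 + r\<^sup>2 \<le> T\<close>.\<close>

lemma speed_bounds: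
  fixes r q f g \<delta> K :: real
  assumes qr: "q + r = \<delta> * f" "q - r = g" and K: "f\<^sup>2 + g\<^sup>2 \<le> K"
    and \<delta>: "\<bar>\<delta>\<bar> \<le> 1 / (2 * (1 + K)\<^sup>2)"
  shows "0 < 1 + r\<^sup>2 - q\<^sup>2" "1 - 1 / (8 * (1 + K)) \<le> speed_p r q"
    "speed_m r q \<le> 1 - 1 / (2 * (1 + K))"
proof -
  define T where "T = 1 + K"
  have K0: "0 \<le> K" using K by (smt (verit) zero_le_power2)
  then have T: "1 \<le> T" "K \<le> T" by (auto simp: T_def)
  have T2: "1 \<le> T\<^sup>2" "T \<le> T\<^sup>2"
    using T by (auto simp: power2_eq_square mult_le_cancel_left1 intro: mult_mono[of 1 T 1 T, simplified])
  have "\<bar>\<delta>\<bar> * T\<^sup>2 \<le> 1 / (2 * T\<^sup>2) * T\<^sup>2"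
    using \<delta> by (intro mult_right_mono) (auto simp: T_def)
  then have dT: "\<bar>\<delta>\<bar> * T\<^sup>2 \<le> 1 / 2" using T by simp
  have "\<bar>\<delta>\<bar> * 1 \<le> \<bar>\<delta>\<bar> * T\<^sup>2" by (intro mult_left_mono T2) simp
  then have d1: "\<bar>\<delta>\<bar> \<le> 1" using dT by simp
  have "(\<bar>\<delta>\<bar> * T\<^sup>2)\<^sup>2 \<le> (1 / 2)\<^sup>2" by (intro power_mono dT) auto
  then have d2: "\<delta>\<^sup>2 * T\<^sup>2 * T\<^sup>2 \<le> 1 / 4" 
    unfolding power_mult_distrib power2_abs power2_eq_square[of "T\<^sup>2"]
    by (simp add: power2_eq_square mult.assoc)
  have "\<delta>\<^sup>2 * T\<^sup>2 * T \<le> \<delta>\<^sup>2 * T\<^sup>2 * T\<^sup>2" by (intro mult_left_mono T2) simp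
  then have d3: "\<delta>\<^sup>2 * T\<^sup>2 \<le> 1 / (4 * T)"
    using d2 T by (simp add: pos_le_divide_eq mult.commute)
  have f2: "f\<^sup>2 \<le> K" "g\<^sup>2 \<le> K" using K by (smt (verit) zero_le_power2)+
  have fg: "\<bar>f * g\<bar> \<le> K"
  proof -
    have "2 * \<bar>f * g\<bar> \<le> f\<^sup>2 + g\<^sup>2"
      using sum_squares_bound[of "\<bar>f\<bar>" "\<bar>g\<bar>"] by (simp add: abs_mult)
    then show ?thesis using K abs_ge_zero[of "f * g"] by linarith
  qed
  have eg: "1 + r\<^sup>2 - q\<^sup>2 = 1 - \<delta> * (f * g)"
  proof -
    have "1 + r\<^sup>2 - q\<^sup>2 = 1 - (q + r) * (q - r)" by (simp add: power2_eq_square algebra_simps)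
    then show ?thesis unfolding qr by simp
  qed
  have "\<bar>\<delta> * (f * g)\<bar> \<le> \<bar>\<delta>\<bar> * T\<^sup>2"
    unfolding abs_mult[of \<delta>] using fg T T2 by (intro mult_left_mono) auto
  then show pos: "0 < 1 + r\<^sup>2 - q\<^sup>2" using eg dT by linarith
  define S where "S = sqrt (1 + r\<^sup>2 - q\<^sup>2)"
  have S: "0 < S" "S\<^sup>2 = 1 + r\<^sup>2 - q\<^sup>2" using pos by (auto simp: S_def)
  have r1: "1 \<le> 1 + r\<^sup>2" "1 + r\<^sup>2 \<le> T"
  proof -
    have "4 * r\<^sup>2 = ((q + r) - (q - r))\<^sup>2" by (simp add: power2_eq_square algebra_simps)
    also have "\<dots> \<le> 2 * ((\<delta> * f)\<^sup>2 + g\<^sup>2)"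
      unfolding qr using sum_squares_bound[of "\<delta> * f" "- g"] by (simp add: power2_eq_square algebra_simps)
    also have "\<dots> \<le> 2 * (1 * K + K)"
    proof -
      have "\<delta>\<^sup>2 * f\<^sup>2 \<le> 1 * K"
        using d1 f2 K0 by (intro mult_mono) (auto simp: abs_square_le_1)
      then show ?thesis using f2 by (simp add: power_mult_distrib)
    qed
    finally show "1 + r\<^sup>2 \<le> T" by (simp add: T_def)
  qed simp
  have "(q + r)\<^sup>2 + (1 - S)\<^sup>2 \<le> \<delta>\<^sup>2 * T\<^sup>2"
  proof -
    \<comment> \<open>Multiplying by \<open>(1 + S)\<^sup>2 \<ge> 1\<close> replaces the root by
      \<open>1 - S\<^sup>2 = \<delta> * f * g\<close>.\<close>
    have "(1 - S)\<^sup>2 * 1 \<le> (1 - S)\<^sup>2 * (1 + S)\<^sup>2"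
      using S(1) by (intro mult_left_mono one_le_power) auto
    also have "\<dots> = (1 - S\<^sup>2)\<^sup>2" by (simp add: power2_eq_square algebra_simps)
    also have "\<dots> = \<delta>\<^sup>2 * (f * g)\<^sup>2" unfolding S(2) eg by (simp add: power_mult_distrib)
    also have "\<dots> \<le> \<delta>\<^sup>2 * (K * K)"
      using mult_mono[OF f2] K0 by (intro mult_left_mono) (auto simp: power_mult_distrib)
    finally have "(1 - S)\<^sup>2 \<le> \<delta>\<^sup>2 * (K * K)" by simp
    moreover have "(q + r)\<^sup>2 \<le> \<delta>\<^sup>2 * K"
      unfolding qr power_mult_distrib using f2 by (intro mult_left_mono) auto
    ultimately have "(q + r)\<^sup>2 + (1 - S)\<^sup>2 \<le> \<delta>\<^sup>2 * (K + K * K)" by (simp add: algebra_simps)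
    also have "\<dots> \<le> \<delta>\<^sup>2 * T\<^sup>2"
      using K0 by (intro mult_left_mono) (auto simp: T_def power2_eq_square algebra_simps)
    finally show ?thesis .
  qed
  also have "\<dots> \<le> 1 / (4 * T)" by (rule d3)
  finally have num: "(q + r)\<^sup>2 + (1 - S)\<^sup>2 \<le> 1 / (4 * T)" .
  have "1 - speed_p r q = ((q + r)\<^sup>2 + (1 - S)\<^sup>2) / (2 * (1 + r\<^sup>2))"
    by (rule one_minus_null_root[OF S(2)]) (simp add: speed_p_def S_def)
  also have "\<dots> \<le> (1 / (4 * T)) / (2 * 1)"
    by (rule frac_le) (use num r1 T in auto)
  finally show "1 - 1 / (8 * (1 + K)) \<le> speed_p r q" by (simp add: T_def)
  have "1 / (2 * T) \<le> ((q + r)\<^sup>2 + (1 - - S)\<^sup>2) / (2 * (1 + r\<^sup>2))"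
  proof (rule frac_le)
    have "1 \<le> (1 + S)\<^sup>2" using S(1) by (intro one_le_power) simp
    then show "1 \<le> (q + r)\<^sup>2 + (1 - - S)\<^sup>2"
      using zero_le_power2[of "q + r"] unfolding minus_minus diff_minus_eq_add by linarith
    show "0 < 2 * (1 + r\<^sup>2)" using one_plus_square_pos[of r] by (rule mult_pos_pos[rotated]) simp
    show "2 * (1 + r\<^sup>2) \<le> 2 * T" using r1(2) by (rule mult_left_mono) simp
  qed simp
  also have "\<dots> = 1 - speed_m r q"
    by (rule one_minus_null_root[symmetric]) (use S(2) in \<open>auto simp: speed_m_def S_def\<close>)
  finally show "speed_m r q \<le> 1 - 1 / (2 * (1 + K))" by (simp add: T_def)
qed

section \<open>Choice of the constants and conclusion\<close>

theorem theorem1p1: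
  fixes \<gamma> I :: real
  assumes "0 < \<gamma>" and "\<gamma> < 1" and "0 < I"
  shows "\<exists>\<delta>0>0. \<forall>\<delta>::real. \<bar>\<delta>\<bar> \<le> \<delta>0 \<longrightarrow>
    (\<forall>F G. smooth F \<and> smooth G \<and>
      (\<exists>f g. smooth f \<and> smooth g \<and> weighted_bound \<gamma> I f g \<and>
         (\<forall>x. G x + deriv F x = \<delta> * f x) \<and> (\<forall>x. G x - deriv F x = g x)) \<longrightarrow>
      (\<exists>\<phi>. smooth_string_solution F G \<phi> \<and>
         (\<forall>\<psi>. smooth_string_solution F G \<psi> \<longrightarrow> (\<forall>p\<in>half_plane. \<psi> p = \<phi> p))))"
proof (intro exI[of _ "1 / (2 * (1 + 3 * I)\<^sup>2)"] conjI allI impI)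
  \<comment> \<open>The threshold is that of \<open>speed_bounds\<close> for the pointwise bound
    \<open>K = 3 * I\<close>.\<close>
  show "0 < 1 / (2 * (1 + 3 * I)\<^sup>2)"
    using \<open>0 < I\<close> by simp
  fix \<delta> F G
  assume \<delta>: "\<bar>\<delta>\<bar> \<le> 1 / (2 * (1 + 3 * I)\<^sup>2)"
    and "smooth F \<and> smooth G \<and> (\<exists>f g. smooth f \<and> smooth g \<and> weighted_bound \<gamma> I f g \<and>
         (\<forall>x. G x + deriv F x = \<delta> * f x) \<and> (\<forall>x. G x - deriv F x = g x))"
  then obtain f g where FG: "smooth F" "smooth G" and fg: "smooth f" "smooth g" "weighted_bound \<gamma> I f g"
    and data: "\<And>x. G x + deriv F x = \<delta> * f x" "\<And>x. G x - deriv F x = g x"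
    by blast
  note bounds = speed_bounds[OF data weighted_bound_imp_bounded[OF \<open>0 < \<gamma>\<close> fg] \<delta>]
  show "\<exists>\<phi>. smooth_string_solution F G \<phi> \<and>
    (\<forall>\<psi>. smooth_string_solution F G \<psi> \<longrightarrow> (\<forall>p\<in>half_plane. \<psi> p = \<phi> p))"
  proof (rule string_cauchy_problem[OF FG bounds(1)])
    \<comment> \<open>The gap is \<open>1 / (2 * T) - 1 / (8 * T)\<close> with
      \<open>T = 1 + 3 * I\<close>.\<close>
    show "0 < 3 / (8 * (1 + 3 * I))"
      using \<open>0 < I\<close> by simp
    show "3 / (8 * (1 + 3 * I)) \<le> speed_p (deriv F x) (G x) - speed_m (deriv F y) (G y)" for x y
      using bounds(2)[of x] bounds(3)[of y] \<open>0 < I\<close> by (simp add: field_simps)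
  qed
qed

end
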